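(* Let $f:2^X\to\mathbb{R}_+$ be any nonnegative submodular function and let $OPT=\max_{S\subseteq X} f(S)$. Then Algorithm 1 (the simulated annealing algorithm described in the context) returns, with high probability, a set $S\subseteq X$ with $f(S)\ge 0.41\cdot OPT$.
   Context: A function $f:2^X\to\mathbb{R}$ is submodular if $f(S\cup T)+f(S\cap T)\le f(S)+f(T)$ for all $S,T\subseteq X$; $f$ is accessed through a value oracle returning $f(S)$ for a queried $S$. Let $n=|X|$. The multilinear extension of $f$ is $F:[0,1]^X\to\mathbb{R}$, $F(\mathbf{x})=\mathbb{E}[f(R)]=\sum_{S\subseteq X} f(S)\prod_{i\in S}x_i\prod_{j\notin S}(1-x_j)$, where $R$ contains each $i$ independently with probability $x_i$ (values of $F$ are estimated by random sampling). For $A\subseteq X$ and $p\in[0,1]$ let $\mathbf{x}_p(A)=p\mathbf{1}_A+(1-p)\mathbf{1}_{X\setminus A}$. Algorithm 1: set $\delta=1/n^3$ and $A\leftarrow\emptyset$. For $p=\tfrac12,\tfrac12+\delta,\tfrac12+2\delta,\dots$ as long as $p<1$: while there exists $i\in X$ with $F(\mathbf{x}_p(A\triangle\{i\}))>F(\mathbf{x}_p(A))$, replace $A$ by $A\triangle\{i\}$. At the end, return the set with the largest $f$-value among all sets $A$ and their complements $X\setminus A$ encountered during the execution. *)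

theory Defs
  imports "HOL-Probability.Probability"
begin

definition submodular_on :: "'a set \<Rightarrow> ('a set \<Rightarrow> real) \<Rightarrow> bool" where
  "submodular_on X f \<longleftrightarrow>
     (\<forall>S T. S \<subseteq> X \<longrightarrow> T \<subseteq> X \<longrightarrow> f (S \<union> T) + f (S \<inter> T) \<le> f S + f T)"

definition multilinear :: "'a set \<Rightarrow> ('a set \<Rightarrow> real) \<Rightarrow> ('a \<Rightarrow> real) \<Rightarrow> real" where
  "multilinear X f x = (\<Sum>S\<in>Pow X. f S * (\<Prod>i\<in>S. x i) * (\<Prod>j\<in>X - S. 1 - x j))"

definition random_subset :: "'a set \<Rightarrow> ('a \<Rightarrow> real) \<Rightarrow> 'a set pmf" where
  "random_subset X x = map_pmf Collect (Pi_pmf X False (\<lambda>i. bernoulli_pmf (x i)))"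

lemma set_pmf_random_subset:
  assumes "finite X"
  shows "set_pmf (random_subset X x) \<subseteq> Pow X"
  using set_Pi_pmf_subset[OF assms, of False "\<lambda>i. bernoulli_pmf (x i)"]
  by (auto simp: random_subset_def)

lemma pmf_random_subset:
  assumes "finite X" "S \<subseteq> X" "\<And>i. i \<in> X \<Longrightarrow> 0 \<le> x i \<and> x i \<le> 1"
  shows "pmf (random_subset X x) S = (\<Prod>i\<in>S. x i) * (\<Prod>j\<in>X - S. 1 - x j)"
proof -
  have inj: "inj (Collect :: ('a \<Rightarrow> bool) \<Rightarrow> 'a set)"
    by (auto intro!: injI)
  have "pmf (random_subset X x) S =
      pmf (map_pmf Collect (Pi_pmf X False (\<lambda>i. bernoulli_pmf (x i)))) (Collect (\<lambda>i. i \<in> S))"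
    by (simp add: random_subset_def)
  also have "\<dots> = pmf (Pi_pmf X False (\<lambda>i. bernoulli_pmf (x i))) (\<lambda>i. i \<in> S)"
    by (rule pmf_map_inj'[OF inj])
  also have "\<dots> = (\<Prod>i\<in>X. pmf (bernoulli_pmf (x i)) (i \<in> S))"
    using assms by (subst pmf_Pi') auto
  also have "\<dots> = (\<Prod>i\<in>X. if i \<in> S then x i else 1 - x i)"
    using assms(3) by (intro prod.cong) auto
  also have "\<dots> = (\<Prod>i\<in>X \<inter> S. x i) * (\<Prod>i\<in>X - S. 1 - x i)"
    using assms(1) by (simp add: prod.If_cases Diff_eq Compl_eq)
  finally show ?thesis
    using assms(2) by (simp add: Int_absorb1)
qed

lemma expectation_random_subset:
  assumes "finite X" "\<And>i. i \<in> X \<Longrightarrow> 0 \<le> x i \<and> x i \<le> 1"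
  shows "measure_pmf.expectation (random_subset X x) f = multilinear X f x"
proof -
  have "measure_pmf.expectation (random_subset X x) f =
      (\<Sum>S\<in>Pow X. f S * pmf (random_subset X x) S)"
    using assms(1) set_pmf_random_subset[OF assms(1), of x]
    by (intro integral_measure_pmf_real) auto
  also have "\<dots> = multilinear X f x"
    unfolding multilinear_def using assms
    by (intro sum.cong) (auto simp: pmf_random_subset)
  finally show ?thesis .
qed

definition biased_point :: "'a set \<Rightarrow> real \<Rightarrow> 'a set \<Rightarrow> 'a \<Rightarrow> real" where
  "biased_point X p A = (\<lambda>i. p * indicator A i + (1 - p) * indicator (X - A) i)"

definition bias :: "'a set \<Rightarrow> nat \<Rightarrow> real" where
  "bias X k = 1 / 2 + real k * (1 / real (card X) ^ 3)"

text \<open>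
  A state is \<open>(k, A, H)\<close>: the current phase (with bias \<open>bias X k\<close>), the current set, and the
  collection of all current sets seen so far. The values of the multilinear extension enter
  through the parameter \<open>F\<close>, which may be exact or estimated. The choice of an improving
  element is left nondeterministic.
\<close>

type_synonym 'a anneal_state = "nat \<times> 'a set \<times> 'a set set"

inductive anneal_step ::
  "'a set \<Rightarrow> (('a \<Rightarrow> real) \<Rightarrow> real) \<Rightarrow> 'a anneal_state \<Rightarrow> 'a anneal_state \<Rightarrow> bool"
  for X :: "'a set" and F :: "('a \<Rightarrow> real) \<Rightarrow> real" where
  flip: "\<lbrakk>bias X k < 1; i \<in> X;
      F (biased_point X (bias X k) (sym_diff A {i})) > F (biased_point X (bias X k) A)\<rbrakk> \<Longrightarrow>
    anneal_step X F (k, A, H) (k, sym_diff A {i}, insert (sym_diff A {i}) H)"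
| next_phase: "\<lbrakk>bias X k < 1;
      \<not> (\<exists>i\<in>X. F (biased_point X (bias X k) (sym_diff A {i})) > F (biased_point X (bias X k) A))\<rbrakk> \<Longrightarrow>
    anneal_step X F (k, A, H) (Suc k, A, H)"

definition anneal_init :: "'a anneal_state" where
  "anneal_init = (0, {}, {{}})"

definition anneal_terminates :: "'a set \<Rightarrow> (('a \<Rightarrow> real) \<Rightarrow> real) \<Rightarrow> bool" where
  "anneal_terminates X F \<longleftrightarrow>
     \<not> (\<exists>\<sigma>. \<sigma> 0 = anneal_init \<and> (\<forall>t::nat. anneal_step X F (\<sigma> t) (\<sigma> (Suc t))))"

definition anneal_returns ::
  "'a set \<Rightarrow> ('a set \<Rightarrow> real) \<Rightarrow> (('a \<Rightarrow> real) \<Rightarrow> real) \<Rightarrow> 'a set \<Rightarrow> bool" where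
  "anneal_returns X f F S \<longleftrightarrow>
     (\<exists>k A H. (anneal_step X F)\<^sup>*\<^sup>* anneal_init (k, A, H) \<and> \<not> bias X k < 1 \<and>
        is_arg_max f (\<lambda>T. T \<in> H \<union> (\<lambda>B. X - B) ` H) S)"

definition query_points :: "'a set \<Rightarrow> ('a \<Rightarrow> real) set" where
  "query_points X = {biased_point X (bias X k) A |k A. bias X k < 1 \<and> A \<subseteq> X}"

lemma finite_query_points:
  assumes "finite X" "X \<noteq> {}"
  shows "finite (query_points X)"
proof -
  have n: "real (card X) ^ 3 > 0"
    using assms by (simp add: card_gt_0_iff)
  have "{k. bias X k < 1} \<subseteq> {..card X ^ 3}"
  proof
    fix k assume "k \<in> {k. bias X k < 1}"
    hence "real k * 2 < real (card X) ^ 3"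
      using n by (simp add: bias_def field_simps)
    hence "real k < real (card X ^ 3)"
      unfolding of_nat_power by linarith
    thus "k \<in> {..card X ^ 3}" unfolding of_nat_less_iff by simp
  qed
  hence "finite {k. bias X k < 1}"
    by (rule finite_subset) simp
  moreover have "query_points X = (\<lambda>(k, A). biased_point X (bias X k) A) ` ({k. bias X k < 1} \<times> Pow X)"
    by (auto simp: query_points_def)
  ultimately show ?thesis
    using assms(1) by simp
qed

text \<open>
  For every point \<open>x\<close> that the algorithm may query, \<open>m\<close> independent copies of the random set
  with marginals \<open>x\<close> are drawn, and all queries of \<open>x\<close> are answered by the average value of
  \<open>f\<close> on these sets. The value \<open>{}\<close> given to \<open>Pi_pmf\<close> is a dummy for indices outside the
  (finite) index set.
\<close>

definition sampling :: "'a set \<Rightarrow> nat \<Rightarrow> (('a \<Rightarrow> real) \<times> nat \<Rightarrow> 'a set) pmf" where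
  "sampling X m = Pi_pmf (query_points X \<times> {..<m}) {} (\<lambda>(x, j). random_subset X x)"

definition estimate ::
  "('a set \<Rightarrow> real) \<Rightarrow> nat \<Rightarrow> (('a \<Rightarrow> real) \<times> nat \<Rightarrow> 'a set) \<Rightarrow> ('a \<Rightarrow> real) \<Rightarrow> real" where
  "estimate f m R x = (\<Sum>j<m. f (R (x, j))) / real m"

end

theory Submission imports Defs begin

text \<open>
  Normalise \<open>OPT = f C = 1\<close>, let \<open>\<beta> = 0.41\<close>, and suppose that all sets seen so far and their
  complements have value below \<open>\<beta>\<close>. Write \<open>q = 1 - p\<close> and let \<open>\<Phi>(p)\<close> be the value of the
  multilinear extension \<open>F\<close> at the local optimum \<open>x = x\<^sub>p(A)\<close> reached for bias \<open>p\<close>.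

  Since \<open>F\<close> is concave along nonnegative directions, \<open>F\<close> at a point that is constant on the four
  blocks cut out by \<open>A\<close> and \<open>C\<close> is at least the expectation of \<open>f\<close> over independent choices of
  whole blocks. This has two consequences.

  \<^item> At \<open>p \<approx> 0.586\<close> local optimality gives
    \<open>2 F(x) \<ge> F(x \<or> (C - A)) + F(x \<and> (X - (A - C)))\<close>, whence
    \<open>2 \<Phi>(p) \<ge> 2 p\<^sup>2 + (1 - \<beta>) p (2 - 3 p) - \<beta> (p\<^sup>2 - 2 q\<^sup>2)\<close>.
  \<^item> For every \<open>p\<close> it gives \<open>q \<Phi>'(p) \<ge> F(x \<or> C) + F(x \<and> C) - 2 F(x) \<ge> 1 - (2 p - 1) \<beta> - 2 \<Phi>(p)\<close>.

  The differential inequality has the exact solutions \<open>(1 - \<beta>) / 2 + 2 \<beta> q - \<gamma> q\<^sup>2\<close>. The initial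
  value permits \<open>\<gamma> = 1.458\<close>, so that \<open>\<Phi>\<close> climbs to \<open>(1 - \<beta>) / 2 + \<beta>\<^sup>2 / \<gamma> > 0.4102\<close> at \<open>q = \<beta> / \<gamma>\<close>
  and stays there because \<open>\<Phi>\<close> is nondecreasing. As \<open>F(x\<^sub>p(A))\<close> tends to \<open>f A\<close> for \<open>p \<rightarrow> 1\<close>, this
  contradicts \<open>f A < \<beta>\<close>. Discretisation and estimation errors sum up to \<open>O(1/n)\<close> when all
  estimates are within \<open>1/n\<^sup>4\<close>, which fails with exponentially small probability by Hoeffding's
  inequality and a union bound; small \<open>n\<close> are absorbed by the constant.
\<close>

section \<open>The multilinear extension of a submodular function\<close>

lemma multilinear_empty [simp]: "multilinear {} f x = f {}"
  by (simp add: multilinear_def)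

lemma multilinear_insert:
  assumes "finite X" "i \<notin> X"
  shows "multilinear (insert i X) f x =
    x i * multilinear X (\<lambda>S. f (insert i S)) x + (1 - x i) * multilinear X f x"
proof -
  let ?w = "\<lambda>Y S. (\<Prod>i\<in>S. x i) * (\<Prod>j\<in>Y - S. 1 - x j)"
  have "Pow X \<inter> insert i ` Pow X = {}" "inj_on (insert i) (Pow X)"
    using assms by (auto simp: inj_on_def)
  then have "multilinear (insert i X) f x =
      (\<Sum>S\<in>Pow X. f S * ?w (insert i X) S) +
      (\<Sum>S\<in>Pow X. f (insert i S) * ?w (insert i X) (insert i S))"
    using assms
    by (simp add: multilinear_def Pow_insert sum.union_disjoint sum.reindex o_def mult.assoc)
  also have "(\<Sum>S\<in>Pow X. f S * ?w (insert i X) S) = (1 - x i) * multilinear X f x"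
    unfolding multilinear_def sum_distrib_left
  proof (rule sum.cong[OF refl])
    fix S assume "S \<in> Pow X"
    then have "insert i X - S = insert i (X - S)" "finite (X - S)" "i \<notin> X - S"
      using assms by auto
    then show "f S * ?w (insert i X) S =
        (1 - x i) * (f S * (\<Prod>i\<in>S. x i) * (\<Prod>j\<in>X - S. 1 - x j))"
      by simp
  qed
  also have "(\<Sum>S\<in>Pow X. f (insert i S) * ?w (insert i X) (insert i S)) =
      x i * multilinear X (\<lambda>S. f (insert i S)) x"
    unfolding multilinear_def sum_distrib_left
  proof (rule sum.cong[OF refl])
    fix S assume "S \<in> Pow X"
    then have "insert i X - insert i S = X - S" "finite S" "i \<notin> S"
      using assms by (auto intro: finite_subset)
    then show "f (insert i S) * ?w (insert i X) (insert i S) =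
        x i * (f (insert i S) * (\<Prod>i\<in>S. x i) * (\<Prod>j\<in>X - S. 1 - x j))"
      by simp
  qed
  finally show ?thesis by simp
qed

lemma multilinear_cong:
  assumes "\<And>i. i \<in> X \<Longrightarrow> x i = y i" "\<And>S. S \<subseteq> X \<Longrightarrow> f S = g S"
  shows "multilinear X f x = multilinear X g y"
  unfolding multilinear_def
  by (intro sum.cong arg_cong2[where f = "(*)"] prod.cong) (use assms in auto)

lemma multilinear_diff:
  "multilinear X (\<lambda>S. f S - g S) x = multilinear X f x - multilinear X g x"
  by (simp add: multilinear_def algebra_simps sum_subtractf)

lemma multilinear_indicator:
  assumes "finite X" "S \<subseteq> X" "\<And>i. i \<in> X \<Longrightarrow> x i = of_bool (i \<in> S)"
  shows "multilinear X f x = f S"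
  using assms
proof (induction X arbitrary: f S rule: finite_induct)
  case (insert i X)
  have eq: "multilinear X g x = g (S - {i})" for g
    by (rule insert.IH) (use insert in auto)
  show ?case
    using insert.prems(2)[of i] insert.hyps
    by (cases "i \<in> S") (simp_all add: multilinear_insert eq insert_absorb)
qed auto

lemma multilinear_mono:
  assumes "finite X" "\<And>S. S \<subseteq> X \<Longrightarrow> f S \<le> g S" "\<And>i. i \<in> X \<Longrightarrow> 0 \<le> x i \<and> x i \<le> 1"
  shows "multilinear X f x \<le> multilinear X g x"
  unfolding multilinear_def mult.assoc
  by (intro sum_mono mult_right_mono mult_nonneg_nonneg prod_nonneg) (use assms in auto)

lemma multilinear_const:
  assumes "finite X"
  shows "multilinear X (\<lambda>S. c) x = c"
  using assms by (induction X rule: finite_induct) (auto simp: multilinear_insert algebra_simps)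

lemma multilinear_antimono:
  assumes "finite X" "\<And>S T. S \<subseteq> T \<Longrightarrow> T \<subseteq> X \<Longrightarrow> g T \<le> g S"
    and "\<And>i. i \<in> X \<Longrightarrow> 0 \<le> x i \<and> x i \<le> y i \<and> y i \<le> 1"
  shows "multilinear X g y \<le> multilinear X g x"
  using assms
proof (induction X arbitrary: g rule: finite_induct)
  case (insert i X)
  let ?g = "\<lambda>S. g (insert i S)"
  have 1: "multilinear X ?g y \<le> multilinear X ?g x" "multilinear X g y \<le> multilinear X g x"
    by (rule insert.IH; use insert.prems in \<open>auto intro!: insert.prems\<close>)+
  have 2: "multilinear X ?g x \<le> multilinear X g x"
    by (rule multilinear_mono) (use insert in \<open>force intro!: insert.prems\<close>)+
  have yi: "0 \<le> y i" "y i \<le> 1" "x i \<le> y i" using insert.prems(2)[of i] by auto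
  have "multilinear (insert i X) g y \<le> y i * multilinear X ?g x + (1 - y i) * multilinear X g x"
    using insert.hyps 1 yi by (auto simp: multilinear_insert intro!: add_mono mult_left_mono)
  also have "\<dots> = multilinear X g x - y i * (multilinear X g x - multilinear X ?g x)"
    by (simp add: algebra_simps)
  also have "\<dots> \<le> multilinear X g x - x i * (multilinear X g x - multilinear X ?g x)"
    using 2 yi by (intro diff_left_mono mult_right_mono) auto
  also have "\<dots> = multilinear (insert i X) g x"
    using insert.hyps by (simp add: multilinear_insert algebra_simps)
  finally show ?case .
qed auto

text \<open>The partial derivative of the multilinear extension in coordinate \<open>i\<close>. It
  lives on \<open>X - {i}\<close> because the extension is affine in \<open>x i\<close>, so its
  slope does not depend on that coordinate.\<close>

definition marginal :: "'a set \<Rightarrow> ('a set \<Rightarrow> real) \<Rightarrow> ('a \<Rightarrow> real) \<Rightarrow> 'a \<Rightarrow> real" where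
  "marginal X f x i = multilinear (X - {i}) (\<lambda>S. f (insert i S) - f S) x"

lemma multilinear_fun_upd:
  assumes "finite X" "i \<in> X"
  shows "multilinear X f (x(i := t)) = multilinear X f x + (t - x i) * marginal X f x i"
proof -
  have X: "X = insert i (X - {i})" using assms by auto
  have rest: "multilinear (X - {i}) g (x(i := t)) = multilinear (X - {i}) g x" for g
    by (rule multilinear_cong) auto
  have eq: "multilinear X f z = multilinear (X - {i}) f z + z i * marginal X f z i" for z
    using assms by (subst X, subst multilinear_insert) (auto simp: marginal_def multilinear_diff algebra_simps)
  show ?thesis
    using eq[of "x(i := t)"] eq[of x] rest by (simp add: marginal_def algebra_simps)
qed

text \<open>Hybrid points for telescoping: passing from \<open>x\<close> to \<open>y\<close> one
  coordinate at a time changes the extension by a single weighted marginal per step.\<close>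

definition mixed_point :: "'a set \<Rightarrow> ('a \<Rightarrow> real) \<Rightarrow> ('a \<Rightarrow> real) \<Rightarrow> 'a \<Rightarrow> real" where
  "mixed_point Y x y = (\<lambda>i. if i \<in> Y then y i else x i)"

lemma mixed_point_insert: "mixed_point (insert i Y) x y = (mixed_point Y x y)(i := y i)"
  by (auto simp: mixed_point_def)

lemma multilinear_mixed_insert:
  assumes "finite X" "i \<in> X" "i \<notin> Y"
  shows "multilinear X f (mixed_point (insert i Y) x y) =
    multilinear X f (mixed_point Y x y) + (y i - x i) * marginal X f (mixed_point Y x y) i"
  unfolding mixed_point_insert using assms
  by (subst multilinear_fun_upd) (auto simp: mixed_point_def)

lemma multilinear_mixed_full: "multilinear X f (mixed_point X x y) = multilinear X f y"
  by (rule multilinear_cong) (auto simp: mixed_point_def)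

lemma mixed_point_empty [simp]: "mixed_point {} x y = x"
  by (simp add: mixed_point_def)

section \<open>Lipschitz and Taylor estimates for functions into [0, 1]\<close>

lemma abs_marginal_le:
  assumes "finite X" "i \<in> X" "\<And>S. S \<subseteq> X \<Longrightarrow> 0 \<le> f S \<and> f S \<le> 1" "\<And>i. i \<in> X \<Longrightarrow> 0 \<le> x i \<and> x i \<le> 1"
  shows "\<bar>marginal X f x i\<bar> \<le> 1"
proof -
  have bd: "- 1 \<le> f (insert i S) - f S \<and> f (insert i S) - f S \<le> 1" if "S \<subseteq> X - {i}" for S
  proof -
    have "insert i S \<subseteq> X" "S \<subseteq> X" using that assms(2) by auto
    from assms(3)[OF this(1)] assms(3)[OF this(2)] show ?thesis by linarith
  qed
  have "multilinear (X - {i}) (\<lambda>S. - 1) x \<le> marginal X f x i"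
    unfolding marginal_def using assms bd by (intro multilinear_mono) auto
  moreover have "marginal X f x i \<le> multilinear (X - {i}) (\<lambda>S. 1) x"
    unfolding marginal_def using assms bd by (intro multilinear_mono) auto
  ultimately show ?thesis using assms(1) by (simp add: multilinear_const)
qed

lemma multilinear_lipschitz:
  assumes "finite X" "\<And>S. S \<subseteq> X \<Longrightarrow> 0 \<le> f S \<and> f S \<le> 1"
    and "\<And>i. i \<in> X \<Longrightarrow> 0 \<le> x i \<and> x i \<le> 1" "\<And>i. i \<in> X \<Longrightarrow> 0 \<le> y i \<and> y i \<le> 1"
  shows "\<bar>multilinear X f y - multilinear X f x\<bar> \<le> (\<Sum>i\<in>X. \<bar>y i - x i\<bar>)"
proof -
  have "\<bar>multilinear X f (mixed_point Y x y) - multilinear X f x\<bar> \<le> (\<Sum>i\<in>Y. \<bar>y i - x i\<bar>)"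
    if "Y \<subseteq> X" for Y
    using finite_subset[OF that assms(1)] that
  proof (induction Y rule: finite_induct)
    case (insert i Y)
    let ?z = "mixed_point Y x y"
    have "\<bar>marginal X f ?z i\<bar> \<le> 1"
      using insert.prems assms by (intro abs_marginal_le) (auto simp: mixed_point_def)
    then have "\<bar>(y i - x i) * marginal X f ?z i\<bar> \<le> \<bar>y i - x i\<bar> * 1"
      unfolding abs_mult by (intro mult_left_mono) auto
    then show ?case
      using insert assms(1) by (simp add: multilinear_mixed_insert)
  qed auto
  from this[of X] show ?thesis by (simp add: multilinear_mixed_full)
qed

text \<open>A marginal is the difference of two multilinear extensions of functions into [0, 1],
  each 1-Lipschitz in the sum norm; hence the factor 2.\<close>

lemma marginal_lipschitz:
  assumes "finite X" "i \<in> X" "\<And>S. S \<subseteq> X \<Longrightarrow> 0 \<le> f S \<and> f S \<le> 1"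
    and "\<And>i. i \<in> X \<Longrightarrow> 0 \<le> x i \<and> x i \<le> 1" "\<And>i. i \<in> X \<Longrightarrow> 0 \<le> y i \<and> y i \<le> 1"
  shows "\<bar>marginal X f y i - marginal X f x i\<bar> \<le> 2 * (\<Sum>i\<in>X. \<bar>y i - x i\<bar>)"
proof -
  have "\<bar>multilinear (X - {i}) g y - multilinear (X - {i}) g x\<bar> \<le> (\<Sum>i\<in>X - {i}. \<bar>y i - x i\<bar>)"
    if "\<And>S. S \<subseteq> X - {i} \<Longrightarrow> 0 \<le> g S \<and> g S \<le> 1" for g
    using that assms by (intro multilinear_lipschitz) auto
  from this[of f] this[of "\<lambda>S. f (insert i S)"]
  have "\<bar>marginal X f y i - marginal X f x i\<bar> \<le> 2 * (\<Sum>i\<in>X - {i}. \<bar>y i - x i\<bar>)"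
    using assms(2,3) unfolding marginal_def multilinear_diff by (auto simp: subset_Diff_insert)
  also have "\<dots> \<le> 2 * (\<Sum>i\<in>X. \<bar>y i - x i\<bar>)"
    using assms(1) by (intro mult_left_mono sum_mono2) auto
  finally show ?thesis .
qed

text \<open>Along the hybrids every marginal stays within \<open>2 * L\<close> of its value at
  \<open>x\<close>; weighted by the step lengths, which sum to \<open>L\<close>, the deviations
  total at most \<open>2 * L\<^sup>2\<close>.\<close>

lemma multilinear_taylor:
  assumes "finite X" "\<And>S. S \<subseteq> X \<Longrightarrow> 0 \<le> f S \<and> f S \<le> 1"
    and "\<And>i. i \<in> X \<Longrightarrow> 0 \<le> x i \<and> x i \<le> 1" "\<And>i. i \<in> X \<Longrightarrow> 0 \<le> y i \<and> y i \<le> 1"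
  defines "L \<equiv> \<Sum>i\<in>X. \<bar>y i - x i\<bar>"
  shows "multilinear X f x + (\<Sum>i\<in>X. (y i - x i) * marginal X f x i) - 2 * L\<^sup>2 \<le> multilinear X f y"
proof -
  have "multilinear X f x + (\<Sum>i\<in>Y. (y i - x i) * marginal X f x i) - 2 * L * (\<Sum>i\<in>Y. \<bar>y i - x i\<bar>)
      \<le> multilinear X f (mixed_point Y x y)" if "Y \<subseteq> X" for Y
    using finite_subset[OF that assms(1)] that
  proof (induction Y rule: finite_induct)
    case (insert i Y)
    let ?z = "mixed_point Y x y"
    have "\<bar>marginal X f ?z i - marginal X f x i\<bar> \<le> 2 * (\<Sum>i\<in>X. \<bar>?z i - x i\<bar>)"
      using insert.prems assms by (intro marginal_lipschitz) (auto simp: mixed_point_def)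
    also have "(\<Sum>i\<in>X. \<bar>?z i - x i\<bar>) \<le> L"
      unfolding L_def by (intro sum_mono) (auto simp: mixed_point_def)
    finally have "\<bar>(y i - x i) * (marginal X f ?z i - marginal X f x i)\<bar> \<le> \<bar>y i - x i\<bar> * (2 * L)"
      unfolding abs_mult by (intro mult_left_mono) auto
    then have "(y i - x i) * marginal X f x i - 2 * L * \<bar>y i - x i\<bar> \<le> (y i - x i) * marginal X f ?z i"
      by (simp add: abs_le_iff algebra_simps)
    then show ?case
      using insert assms(1) by (simp add: multilinear_mixed_insert algebra_simps)
  qed auto
  from this[of X] show ?thesis by (simp add: multilinear_mixed_full L_def power2_eq_square)
qed

section \<open>Concavity along nonnegative directions\<close>

lemma marginal_antimono:
  assumes "finite X" "submodular_on X f" "i \<in> X"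
    and "\<And>i. i \<in> X \<Longrightarrow> 0 \<le> x i \<and> x i \<le> y i \<and> y i \<le> 1"
  shows "marginal X f y i \<le> marginal X f x i"
  unfolding marginal_def
proof (rule multilinear_antimono)
  fix S T assume ST: "S \<subseteq> T" "T \<subseteq> X - {i}"
  then have "f (insert i S \<union> T) + f (insert i S \<inter> T) \<le> f (insert i S) + f T"
    using assms(2,3) unfolding submodular_on_def by (metis Diff_subset insert_subset subset_trans)
  moreover have "insert i S \<union> T = insert i T" "insert i S \<inter> T = S" using ST by auto
  ultimately show "f (insert i T) - f T \<le> f (insert i S) - f S" by simp
qed (use assms in auto)

text \<open>By diminishing returns the marginal at each hybrid is at most the one at
  \<open>x\<close>, and the steps are nonnegative.\<close>

lemma multilinear_tangent_up:
  assumes "finite X" "submodular_on X f"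
    and "\<And>i. i \<in> X \<Longrightarrow> 0 \<le> x i \<and> x i \<le> y i \<and> y i \<le> 1"
  shows "multilinear X f y \<le> multilinear X f x + (\<Sum>i\<in>X. (y i - x i) * marginal X f x i)"
proof -
  have "multilinear X f (mixed_point Y x y) \<le> multilinear X f x + (\<Sum>i\<in>Y. (y i - x i) * marginal X f x i)"
    if "Y \<subseteq> X" for Y
    using finite_subset[OF that assms(1)] that
  proof (induction Y rule: finite_induct)
    case (insert i Y)
    have "marginal X f (mixed_point Y x y) i \<le> marginal X f x i"
      by (rule marginal_antimono) (use insert.prems assms in \<open>auto simp: mixed_point_def intro: order_trans\<close>)
    then have "(y i - x i) * marginal X f (mixed_point Y x y) i \<le> (y i - x i) * marginal X f x i"
      using insert.prems assms(3) by (intro mult_left_mono) auto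
    then show ?case
      using insert assms(1) by (simp add: multilinear_mixed_insert)
  qed auto
  from this[of X] show ?thesis by (simp add: multilinear_mixed_full)
qed

text \<open>Downwards both signs flip: the hybrids have larger marginals, but the steps are
  nonpositive.\<close>

lemma multilinear_tangent_down:
  assumes "finite X" "submodular_on X f"
    and "\<And>i. i \<in> X \<Longrightarrow> 0 \<le> y i \<and> y i \<le> x i \<and> x i \<le> 1"
  shows "multilinear X f y \<le> multilinear X f x + (\<Sum>i\<in>X. (y i - x i) * marginal X f x i)"
proof -
  have "multilinear X f (mixed_point Y x y) \<le> multilinear X f x + (\<Sum>i\<in>Y. (y i - x i) * marginal X f x i)"
    if "Y \<subseteq> X" for Y
    using finite_subset[OF that assms(1)] that
  proof (induction Y rule: finite_induct)
    case (insert i Y)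
    have "marginal X f x i \<le> marginal X f (mixed_point Y x y) i"
      by (rule marginal_antimono) (use insert.prems assms in \<open>auto simp: mixed_point_def intro: order_trans\<close>)
    then have "(y i - x i) * marginal X f (mixed_point Y x y) i \<le> (y i - x i) * marginal X f x i"
      using insert.prems assms(3) by (intro mult_left_mono_neg) auto
    then show ?case
      using insert assms(1) by (simp add: multilinear_mixed_insert)
  qed auto
  from this[of X] show ?thesis by (simp add: multilinear_mixed_full)
qed

text \<open>Both end points lie below the tangent at the intermediate point \<open>z\<close>, and
  the first-order terms cancel in the convex combination.\<close>

lemma multilinear_concave_up:
  assumes "finite X" "submodular_on X f" "0 \<le> t" "t \<le> 1"
    and "\<And>i. i \<in> X \<Longrightarrow> 0 \<le> x i \<and> x i \<le> y i \<and> y i \<le> 1"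
    and "\<And>i. i \<in> X \<Longrightarrow> z i = (1 - t) * x i + t * y i"
  shows "(1 - t) * multilinear X f x + t * multilinear X f y \<le> multilinear X f z"
proof -
  let ?D = "\<Sum>i\<in>X. (y i - x i) * marginal X f z i"
  have xzy: "0 \<le> x i \<and> x i \<le> z i \<and> z i \<le> y i \<and> y i \<le> 1" if "i \<in> X" for i
  proof -
    have "z i = x i + t * (y i - x i)" "z i = y i - (1 - t) * (y i - x i)"
      using assms(6)[OF that] by (auto simp: algebra_simps)
    moreover have "0 \<le> t * (y i - x i)" "0 \<le> (1 - t) * (y i - x i)" using assms(3-5) that by auto
    ultimately show ?thesis using assms(5)[OF that] by linarith
  qed
  have "multilinear X f y \<le> multilinear X f z + (\<Sum>i\<in>X. (y i - z i) * marginal X f z i)"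
    using xzy assms by (intro multilinear_tangent_up) (auto intro: order_trans)
  also have "(\<Sum>i\<in>X. (y i - z i) * marginal X f z i) = (1 - t) * ?D"
    unfolding sum_distrib_left by (intro sum.cong) (auto simp: assms(6) algebra_simps)
  finally have 1: "multilinear X f y \<le> multilinear X f z + (1 - t) * ?D" .
  have "multilinear X f x \<le> multilinear X f z + (\<Sum>i\<in>X. (x i - z i) * marginal X f z i)"
    using xzy assms by (intro multilinear_tangent_down) (auto intro: order_trans)
  also have "(\<Sum>i\<in>X. (x i - z i) * marginal X f z i) = - t * ?D"
    unfolding sum_distrib_left by (intro sum.cong) (auto simp: assms(6) algebra_simps)
  finally have 2: "multilinear X f x \<le> multilinear X f z - t * ?D" by simp
  have "(1 - t) * multilinear X f x + t * multilinear X f y \<le>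
      (1 - t) * (multilinear X f z - t * ?D) + t * (multilinear X f z + (1 - t) * ?D)"
    using 1 2 assms(3,4) by (intro add_mono mult_left_mono) auto
  also have "\<dots> = multilinear X f z" by (simp add: algebra_simps)
  finally show ?thesis .
qed

section \<open>Values on the blocks cut out by two sets\<close>

lemma convex_combination_mono:
  fixes t u u' v v' :: real
  assumes "0 \<le> t" "t \<le> 1" "u \<le> u'" "v \<le> v'"
  shows "t * u + (1 - t) * v \<le> t * u' + (1 - t) * v'"
  using assms by (intro add_mono mult_left_mono) auto

definition block_point :: "'a set \<Rightarrow> 'a set \<Rightarrow> real \<Rightarrow> real \<Rightarrow> real \<Rightarrow> real \<Rightarrow> 'a \<Rightarrow> real" where
  "block_point A C a b c d =
    (\<lambda>i. if i \<in> A then (if i \<in> C then a else b) else (if i \<in> C then c else d))"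

definition block_set :: "'a set \<Rightarrow> 'a set \<Rightarrow> 'a set \<Rightarrow> bool \<Rightarrow> bool \<Rightarrow> bool \<Rightarrow> bool \<Rightarrow> 'a set" where
  "block_set X A C a b c d =
    {i \<in> X. if i \<in> A then (if i \<in> C then a else b) else (if i \<in> C then c else d)}"

lemma block_set_submodular:
  assumes "submodular_on X f"
  shows "f (block_set X A C (a \<or> a') (b \<or> b') (c \<or> c') (d \<or> d')) +
      f (block_set X A C (a \<and> a') (b \<and> b') (c \<and> c') (d \<and> d')) \<le>
    f (block_set X A C a b c d) + f (block_set X A C a' b' c' d')"
proof -
  let ?S = "block_set X A C a b c d" and ?T = "block_set X A C a' b' c' d'"
  have "f (?S \<union> ?T) + f (?S \<inter> ?T) \<le> f ?S + f ?T"
    using assms unfolding submodular_on_def by (auto simp: block_set_def)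
  moreover have "?S \<union> ?T = block_set X A C (a \<or> a') (b \<or> b') (c \<or> c') (d \<or> d')"
    "?S \<inter> ?T = block_set X A C (a \<and> a') (b \<and> b') (c \<and> c') (d \<and> d')"
    by (auto simp: block_set_def split: if_splits)
  ultimately show ?thesis by simp
qed

text \<open>The left-hand side is the expectation of \<open>f\<close> when each of the four blocks
  is included as a whole, independently. Varying the common value on one block is a nonnegative
  direction, so concavity applies block by block.\<close>

lemma multilinear_block_ge:
  fixes A C X :: "'a set" and a b c d :: real
  assumes "finite X" "submodular_on X f" "a \<in> {0..1}" "b \<in> {0..1}" "c \<in> {0..1}" "d \<in> {0..1}"
  defines "g \<equiv> \<lambda>a b c d. f (block_set X A C a b c d)"
  shows "a * (b * (c * (d * g True True True True + (1 - d) * g True True True False)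
             + (1 - c) * (d * g True True False True + (1 - d) * g True True False False))
           + (1 - b) * (c * (d * g True False True True + (1 - d) * g True False True False)
             + (1 - c) * (d * g True False False True + (1 - d) * g True False False False)))
       + (1 - a) * (b * (c * (d * g False True True True + (1 - d) * g False True True False)
             + (1 - c) * (d * g False True False True + (1 - d) * g False True False False))
           + (1 - b) * (c * (d * g False False True True + (1 - d) * g False False True False)
             + (1 - c) * (d * g False False False True + (1 - d) * g False False False False)))
     \<le> multilinear X f (block_point A C a b c d)"
proof -
  define G where "G a b c d = multilinear X f (block_point A C a b c d)" for a b c d
  have step: "t * multilinear X f y + (1 - t) * multilinear X f x \<le> multilinear X f z"
    if "t \<in> {0..1}" "\<And>i. 0 \<le> x i \<and> x i \<le> y i \<and> y i \<le> 1" "\<And>i. z i = (1 - t) * x i + t * y i"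
    for t x y z
    using multilinear_concave_up[OF assms(1,2), of t x y z] that by auto
  have 1: "a * G 1 b c d + (1 - a) * G 0 b c d \<le> G a b c d"
    if "a \<in> {0..1}" "b \<in> {0..1}" "c \<in> {0..1}" "d \<in> {0..1}" for a b c d
    unfolding G_def by (rule step) (use that in \<open>auto simp: block_point_def algebra_simps\<close>)
  have 2: "b * G a 1 c d + (1 - b) * G a 0 c d \<le> G a b c d"
    if "a \<in> {0..1}" "b \<in> {0..1}" "c \<in> {0..1}" "d \<in> {0..1}" for a b c d
    unfolding G_def by (rule step) (use that in \<open>auto simp: block_point_def algebra_simps\<close>)
  have 3: "c * G a b 1 d + (1 - c) * G a b 0 d \<le> G a b c d"
    if "a \<in> {0..1}" "b \<in> {0..1}" "c \<in> {0..1}" "d \<in> {0..1}" for a b c d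
    unfolding G_def by (rule step) (use that in \<open>auto simp: block_point_def algebra_simps\<close>)
  have 4: "d * G a b c 1 + (1 - d) * G a b c 0 \<le> G a b c d"
    if "a \<in> {0..1}" "b \<in> {0..1}" "c \<in> {0..1}" "d \<in> {0..1}" for a b c d
    unfolding G_def by (rule step) (use that in \<open>auto simp: block_point_def algebra_simps\<close>)
  have g: "g a b c d = G (of_bool a) (of_bool b) (of_bool c) (of_bool d)" for a b c d
    unfolding g_def G_def using assms(1)
    by (intro multilinear_indicator[symmetric]) (auto simp: block_set_def block_point_def)
  have 34: "c * (d * G a b 1 1 + (1 - d) * G a b 1 0) + (1 - c) * (d * G a b 0 1 + (1 - d) * G a b 0 0)
      \<le> G a b c d"
    if "a \<in> {0..1}" "b \<in> {0..1}" "c \<in> {0..1}" "d \<in> {0..1}" for a b c d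
    by (rule order_trans[OF convex_combination_mono 3]) (use that 4 in auto)
  have 234: "b * (c * (d * G a 1 1 1 + (1 - d) * G a 1 1 0) + (1 - c) * (d * G a 1 0 1 + (1 - d) * G a 1 0 0))
      + (1 - b) * (c * (d * G a 0 1 1 + (1 - d) * G a 0 1 0) + (1 - c) * (d * G a 0 0 1 + (1 - d) * G a 0 0 0))
      \<le> G a b c d"
    if "a \<in> {0..1}" "b \<in> {0..1}" "c \<in> {0..1}" "d \<in> {0..1}" for a b c d
    by (rule order_trans[OF convex_combination_mono 2]) (use that 34[of a _ c d] in auto)
  show ?thesis
    unfolding g G_def[symmetric] of_bool_eq
    by (rule order_trans[OF convex_combination_mono 1]) (use assms(3-6) 234[of _ b c d] in auto)
qed

text \<open>Since \<open>F(x \<or> C) + F(x \<and> C)\<close> dominates the values on the blocks cut out by \<open>A\<close> and \<open>C\<close>,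
  submodularity of \<open>f\<close> recovers \<open>f C\<close> up to a multiple of \<open>f (X - A)\<close>.\<close>

lemma join_meet_ge:
  assumes "finite X" "submodular_on X f" "\<And>S. S \<subseteq> X \<Longrightarrow> 0 \<le> f S" "C \<subseteq> X" "1 / 2 \<le> p" "p \<le> 1"
  shows "f C - (2 * p - 1) * f (X - A) \<le>
    multilinear X f (block_point A C 1 p 1 (1 - p)) + multilinear X f (block_point A C p 0 (1 - p) 0)"
proof -
  define g where "g a b c d = f (block_set X A C a b c d)" for a b c d
  let ?T = True and ?F = False
  define q where "q = 1 - p"
  have C: "f C = g ?T ?F ?T ?F" and B: "f (X - A) = g ?F ?F ?T ?T"
    unfolding g_def using assms(4) by (auto simp: block_set_def intro!: arg_cong[where f = f])
  have nn: "0 \<le> g a b c d" for a b c d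
    unfolding g_def by (rule assms(3)) (auto simp: block_set_def)
  have sm: "g (a \<or> a') (b \<or> b') (c \<or> c') (d \<or> d') + g (a \<and> a') (b \<and> b') (c \<and> c') (d \<and> d')
      \<le> g a b c d + g a' b' c' d'" for a b c d a' b' c' d'
    unfolding g_def by (rule block_set_submodular[OF assms(2)])
  have q: "0 \<le> q" "q \<le> 1" "0 \<le> p" "p \<le> 1" "1 - p = q" "1 - q = p" "q \<le> p" "p + q = 1"
    using assms by (auto simp: q_def)
  have up: "p * (q * g ?T ?T ?T ?T + p * g ?T ?T ?T ?F) + q * (q * g ?T ?F ?T ?T + p * g ?T ?F ?T ?F)
      \<le> multilinear X f (block_point A C 1 p 1 q)"
    using multilinear_block_ge[OF assms(1,2), of 1 p 1 q A C, folded g_def] q by simp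
  have dn: "p * (q * g ?T ?F ?T ?F + p * g ?T ?F ?F ?F) + q * (q * g ?F ?F ?T ?F + p * g ?F ?F ?F ?F)
      \<le> multilinear X f (block_point A C p 0 q 0)"
    using multilinear_block_ge[OF assms(1,2), of p 0 q 0 A C, folded g_def] q by simp
  \<comment> \<open>Within \<open>X\<close>, the pattern \<open>?T ?F ?F ?F\<close> is
    \<open>A \<inter> C\<close>, \<open>?F ?F ?T ?F\<close> is \<open>C - A\<close>,
    \<open>?T ?T ?T ?F\<close> is \<open>A \<union> C\<close>, and \<open>?T ?F ?T ?T\<close> is
    \<open>X - (A - C)\<close>.\<close>
  have 1: "g ?T ?F ?T ?F \<le> g ?T ?F ?F ?F + g ?F ?F ?T ?F"
    using sm[of ?T ?F ?F ?F ?F ?T ?F ?F] nn[of ?F ?F ?F ?F] by simp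
  have 2: "g ?T ?F ?T ?F \<le> g ?T ?T ?T ?F + g ?T ?F ?T ?T"
    using sm[of ?T ?T ?T ?F ?T ?T ?F ?T] nn[of ?T ?T ?T ?T] by simp
  have 3: "g ?F ?F ?T ?F \<le> g ?T ?T ?T ?F + g ?F ?F ?T ?T"
    using sm[of ?T ?F ?T ?F ?T ?T ?F ?T] nn[of ?T ?T ?T ?T] by simp
  define E where "E = p * (q * g ?T ?T ?T ?T + p * g ?T ?T ?T ?F) + q * (q * g ?T ?F ?T ?T + p * g ?T ?F ?T ?F)
      + (p * (q * g ?T ?F ?T ?F + p * g ?T ?F ?F ?F) + q * (q * g ?F ?F ?T ?F + p * g ?F ?F ?F ?F))"
  \<comment> \<open>The sets \<open>A \<inter> C\<close> and \<open>A \<union> C\<close> have weight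
    \<open>p\<^sup>2 = q\<^sup>2 + (p - q)\<close>. The part \<open>q\<^sup>2\<close> pairs off with
    \<open>C - A\<close> and \<open>X - (A - C)\<close> by 1 and 2. The excess \<open>p - q\<close>
    is paired within itself by 1 and 3, at the cost of \<open>f (X - A)\<close>.\<close>
  have "E = g ?T ?F ?T ?F - (2 * p - 1) * g ?F ?F ?T ?T
      + q\<^sup>2 * (g ?T ?F ?F ?F + g ?F ?F ?T ?F - g ?T ?F ?T ?F)
      + q\<^sup>2 * (g ?T ?T ?T ?F + g ?T ?F ?T ?T - g ?T ?F ?T ?F)
      + (p - q) * (g ?T ?F ?F ?F + g ?T ?T ?T ?F - (g ?T ?F ?T ?F - g ?F ?F ?T ?T))
      + p * q * g ?T ?T ?T ?T + p * q * g ?F ?F ?F ?F"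
    unfolding E_def q_def by (simp add: algebra_simps power2_eq_square)
  moreover have "0 \<le> q\<^sup>2 * (g ?T ?F ?F ?F + g ?F ?F ?T ?F - g ?T ?F ?T ?F)"
    "0 \<le> q\<^sup>2 * (g ?T ?T ?T ?F + g ?T ?F ?T ?T - g ?T ?F ?T ?F)"
    "0 \<le> (p - q) * (g ?T ?F ?F ?F + g ?T ?T ?T ?F - (g ?T ?F ?T ?F - g ?F ?F ?T ?T))"
    "0 \<le> p * q * g ?T ?T ?T ?T" "0 \<le> p * q * g ?F ?F ?F ?F"
    using 1 2 3 q nn by simp_all
  moreover have "E \<le> multilinear X f (block_point A C 1 p 1 q) + multilinear X f (block_point A C p 0 q 0)"
    unfolding E_def using up dn by (rule add_mono)
  ultimately show ?thesis
    unfolding C B q(5) by linarith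
qed

text \<open>Expanding both points over the blocks and uncrossing pairs of sets leaves copies of
  \<open>C\<close>, paid for by \<open>A\<close> and \<open>X - A\<close>. The bounds on
  \<open>p\<close> make the uncrossing weights \<open>s\<close> and \<open>t\<close>
  nonnegative.\<close>

lemma partial_join_meet_ge:
  assumes "finite X" "submodular_on X f" "\<And>S. S \<subseteq> X \<Longrightarrow> 0 \<le> f S" "A \<subseteq> X" "C \<subseteq> X"
    and "1 / 2 \<le> p" "p \<le> 2 / 3" "2 * (1 - p)\<^sup>2 \<le> p\<^sup>2"
  shows "(2 * p\<^sup>2 + p * (2 - 3 * p)) * f C - p * (2 - 3 * p) * f A - (p\<^sup>2 - 2 * (1 - p)\<^sup>2) * f (X - A) \<le>
    multilinear X f (block_point A C p p 1 (1 - p)) + multilinear X f (block_point A C p 0 (1 - p) (1 - p))"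
proof -
  define g where "g a b c d = f (block_set X A C a b c d)" for a b c d
  let ?T = True and ?F = False
  define q where "q = 1 - p"
  define s where "s = p * (2 * q - p) / 2"
  define t where "t = (p\<^sup>2 - 2 * p * q\<^sup>2) / 2"
  have C: "f C = g ?T ?F ?T ?F" and B: "f (X - A) = g ?F ?F ?T ?T" and A: "f A = g ?T ?T ?F ?F"
    unfolding g_def using assms(4,5) by (auto simp: block_set_def intro!: arg_cong[where f = f])
  have nn: "0 \<le> g a b c d" for a b c d
    unfolding g_def by (rule assms(3)) (auto simp: block_set_def)
  have sm: "g (a \<or> a') (b \<or> b') (c \<or> c') (d \<or> d') + g (a \<and> a') (b \<and> b') (c \<and> c') (d \<and> d')
      \<le> g a b c d + g a' b' c' d'" for a b c d a' b' c' d'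
    unfolding g_def by (rule block_set_submodular[OF assms(2)])
  have q: "0 \<le> q" "q \<le> 1" "0 \<le> p" "p \<le> 1" "1 - p = q" "1 - q = p" "q \<le> p"
    using assms by (auto simp: q_def)
  have s: "0 \<le> s" unfolding s_def using assms(6,7) by (auto simp: q_def)
  have "2 * q\<^sup>2 * p \<le> 2 * q\<^sup>2 * 1" using q by (intro mult_left_mono) auto
  then have t: "0 \<le> t" unfolding t_def using assms(8) q by (simp add: algebra_simps)
  have up: "p * (p * (q * g ?T ?T ?T ?T + p * g ?T ?T ?T ?F) + q * (q * g ?T ?F ?T ?T + p * g ?T ?F ?T ?F))
      + q * (p * (q * g ?F ?T ?T ?T + p * g ?F ?T ?T ?F) + q * (q * g ?F ?F ?T ?T + p * g ?F ?F ?T ?F))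
      \<le> multilinear X f (block_point A C p p 1 q)"
    using multilinear_block_ge[OF assms(1,2), of p p 1 q A C, folded g_def] q by simp
  have dn: "p * (q * (q * g ?T ?F ?T ?T + p * g ?T ?F ?T ?F) + p * (q * g ?T ?F ?F ?T + p * g ?T ?F ?F ?F))
      + q * (q * (q * g ?F ?F ?T ?T + p * g ?F ?F ?T ?F) + p * (q * g ?F ?F ?F ?T + p * g ?F ?F ?F ?F))
      \<le> multilinear X f (block_point A C p 0 q q)"
    using multilinear_block_ge[OF assms(1,2), of p 0 q q A C, folded g_def] q by simp
  have 1: "g ?T ?F ?T ?F \<le> g ?T ?F ?F ?F + g ?F ?F ?T ?F"
    using sm[of ?T ?F ?F ?F ?F ?T ?F ?F] nn[of ?F ?F ?F ?F] by simp
  have 2: "g ?T ?F ?T ?F \<le> g ?T ?T ?T ?F + g ?T ?F ?T ?T"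
    using sm[of ?T ?T ?T ?F ?T ?T ?F ?T] nn[of ?T ?T ?T ?T] by simp
  have 3: "g ?T ?T ?T ?F \<le> g ?T ?T ?F ?F + g ?F ?T ?T ?F"
    using sm[of ?T ?F ?T ?T ?F ?T ?F ?F] nn[of ?F ?T ?F ?F] by simp
  have 4: "g ?T ?F ?F ?F \<le> g ?T ?T ?F ?F + g ?T ?F ?F ?T"
    using sm[of ?T ?T ?T ?F ?F ?F ?F ?T] nn[of ?T ?T ?F ?T] by simp
  have 5: "g ?F ?F ?T ?F \<le> g ?F ?F ?T ?T + g ?F ?T ?T ?F"
    using sm[of ?F ?F ?F ?T ?T ?T ?T ?F] nn[of ?F ?T ?T ?T] by simp
  have 6: "g ?T ?F ?T ?T \<le> g ?F ?F ?T ?T + g ?T ?F ?F ?T"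
    using sm[of ?F ?T ?F ?F ?T ?F ?T ?T] nn[of ?F ?F ?F ?T] by simp
  \<comment> \<open>The weights \<open>s\<close> and \<open>t\<close> make \<open>A \<inter> C\<close> and \<open>A \<union> C\<close> as frequent as \<open>C - A\<close> and \<open>X - (A - C)\<close>,
    so that these pair off into copies of \<open>C\<close>: \<open>p\<^sup>3 + s = 2 p q\<^sup>2 + t\<close>.\<close>
  define u where "u = p ^ 3 + s"
  have u: "0 \<le> u" unfolding u_def using q s by simp
  define E where "E = p * (p * (q * g ?T ?T ?T ?T + p * g ?T ?T ?T ?F) + q * (q * g ?T ?F ?T ?T + p * g ?T ?F ?T ?F))
      + q * (p * (q * g ?F ?T ?T ?T + p * g ?F ?T ?T ?F) + q * (q * g ?F ?F ?T ?T + p * g ?F ?F ?T ?F))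
      + (p * (q * (q * g ?T ?F ?T ?T + p * g ?T ?F ?T ?F) + p * (q * g ?T ?F ?F ?T + p * g ?T ?F ?F ?F))
      + q * (q * (q * g ?F ?F ?T ?T + p * g ?F ?F ?T ?F) + p * (q * g ?F ?F ?F ?T + p * g ?F ?F ?F ?F)))"
  have "E = (2 * p\<^sup>2 + p * (2 - 3 * p)) * g ?T ?F ?T ?F - p * (2 - 3 * p) * g ?T ?T ?F ?F
      - (p\<^sup>2 - 2 * q\<^sup>2) * g ?F ?F ?T ?T
      + u * (g ?T ?F ?F ?F + g ?F ?F ?T ?F - g ?T ?F ?T ?F)
      + u * (g ?T ?T ?T ?F + g ?T ?F ?T ?T - g ?T ?F ?T ?F)
      + s * (g ?T ?T ?F ?F + g ?F ?T ?T ?F - g ?T ?T ?T ?F)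
      + s * (g ?T ?T ?F ?F + g ?T ?F ?F ?T - g ?T ?F ?F ?F)
      + t * (g ?F ?F ?T ?T + g ?F ?T ?T ?F - g ?F ?F ?T ?F)
      + t * (g ?F ?F ?T ?T + g ?T ?F ?F ?T - g ?T ?F ?T ?T)
      + p * p * q * g ?T ?T ?T ?T + p * q * q * g ?F ?T ?T ?T
      + p * q * q * g ?F ?F ?F ?T + p * p * q * g ?F ?F ?F ?F"
    unfolding E_def u_def s_def t_def q_def
    by (simp add: field_simps power2_eq_square power3_eq_cube)
  moreover have "0 \<le> u * (g ?T ?F ?F ?F + g ?F ?F ?T ?F - g ?T ?F ?T ?F)"
    "0 \<le> u * (g ?T ?T ?T ?F + g ?T ?F ?T ?T - g ?T ?F ?T ?F)"
    "0 \<le> s * (g ?T ?T ?F ?F + g ?F ?T ?T ?F - g ?T ?T ?T ?F)"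
    "0 \<le> s * (g ?T ?T ?F ?F + g ?T ?F ?F ?T - g ?T ?F ?F ?F)"
    "0 \<le> t * (g ?F ?F ?T ?T + g ?F ?T ?T ?F - g ?F ?F ?T ?F)"
    "0 \<le> t * (g ?F ?F ?T ?T + g ?T ?F ?F ?T - g ?T ?F ?T ?T)"
    "0 \<le> p * p * q * g ?T ?T ?T ?T" "0 \<le> p * q * q * g ?F ?T ?T ?T"
    "0 \<le> p * q * q * g ?F ?F ?F ?T" "0 \<le> p * p * q * g ?F ?F ?F ?F"
    using 1 2 3 4 5 6 u s t q nn by simp_all
  moreover have "E \<le> multilinear X f (block_point A C p p 1 q) + multilinear X f (block_point A C p 0 q q)"
    unfolding E_def using up dn by (rule add_mono)
  ultimately show ?thesis
    unfolding C B A q(5) by linarith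
qed

section \<open>Local optima at a given bias\<close>

lemma biased_point_simps [simp]:
  "i \<in> A \<Longrightarrow> biased_point X p A i = p"
  "i \<in> X \<Longrightarrow> i \<notin> A \<Longrightarrow> biased_point X p A i = 1 - p"
  by (simp_all add: biased_point_def)

text \<open>The share of coordinate \<open>i\<close> in the derivative of the multilinear extension
  at \<open>biased_point X p A\<close> with respect to \<open>p\<close>: growing bias raises
  coordinates in \<open>A\<close> and lowers the others.\<close>

definition bias_gain :: "'a set \<Rightarrow> ('a set \<Rightarrow> real) \<Rightarrow> real \<Rightarrow> 'a set \<Rightarrow> 'a \<Rightarrow> real" where
  "bias_gain X f p A i =
    (if i \<in> A then marginal X f (biased_point X p A) i else - marginal X f (biased_point X p A) i)"

text \<open>A flip replaces one coordinate by its complement to 1, and the extension is affine in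
  it. Hence for \<open>p > 1 / 2\<close> local optimality means exactly that all gains are
  nonnegative.\<close>

lemma multilinear_biased_flip:
  assumes "finite X" "i \<in> X"
  shows "multilinear X f (biased_point X p (sym_diff A {i})) =
    multilinear X f (biased_point X p A) - (2 * p - 1) * bias_gain X f p A i"
proof -
  let ?x = "biased_point X p A"
  have "multilinear X f (biased_point X p (sym_diff A {i})) = multilinear X f (?x(i := 1 - ?x i))"
    by (rule multilinear_cong) (auto simp: biased_point_def indicator_def)
  also have "\<dots> = multilinear X f ?x + (1 - ?x i - ?x i) * marginal X f ?x i"
    using assms by (rule multilinear_fun_upd)
  also have "\<dots> = multilinear X f ?x - (2 * p - 1) * bias_gain X f p A i"
    using assms(2) by (cases "i \<in> A") (simp_all add: bias_gain_def algebra_simps)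
  finally show ?thesis .
qed

lemma biased_increase_ge:
  assumes "finite X" "\<And>S. S \<subseteq> X \<Longrightarrow> 0 \<le> f S \<and> f S \<le> 1" "0 \<le> p" "0 \<le> \<delta>" "p + \<delta> \<le> 1"
  shows "multilinear X f (biased_point X p A) + \<delta> * (\<Sum>i\<in>X. bias_gain X f p A i) - 2 * (real (card X) * \<delta>)\<^sup>2
    \<le> multilinear X f (biased_point X (p + \<delta>) A)"
proof -
  let ?x = "biased_point X p A" and ?y = "biased_point X (p + \<delta>) A"
  have rng: "0 \<le> biased_point X r A i \<and> biased_point X r A i \<le> 1" if "i \<in> X" "0 \<le> r" "r \<le> 1" for i r
    using that by (cases "i \<in> A") auto
  have "multilinear X f ?x + (\<Sum>i\<in>X. (?y i - ?x i) * marginal X f ?x i) - 2 * (\<Sum>i\<in>X. \<bar>?y i - ?x i\<bar>)\<^sup>2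
      \<le> multilinear X f ?y"
    using rng assms by (intro multilinear_taylor) auto
  moreover have "(\<Sum>i\<in>X. (?y i - ?x i) * marginal X f ?x i) = \<delta> * (\<Sum>i\<in>X. bias_gain X f p A i)"
    unfolding sum_distrib_left
  proof (rule sum.cong[OF refl])
    fix i assume "i \<in> X"
    then show "(?y i - ?x i) * marginal X f ?x i = \<delta> * bias_gain X f p A i"
      by (cases "i \<in> A") (simp_all add: bias_gain_def)
  qed
  moreover have "\<bar>?y i - ?x i\<bar> = \<delta>" if "i \<in> X" for i
    using that assms(4) by (cases "i \<in> A") simp_all
  then have "(\<Sum>i\<in>X. \<bar>?y i - ?x i\<bar>) = real (card X) * \<delta>" by simp
  ultimately show ?thesis by simp
qed

lemma abs_biased_diff_le:
  assumes "finite X" "\<And>S. S \<subseteq> X \<Longrightarrow> 0 \<le> f S \<and> f S \<le> 1" "0 \<le> p" "p \<le> 1" "A \<subseteq> X"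
  shows "\<bar>multilinear X f (biased_point X p A) - f A\<bar> \<le> real (card X) * (1 - p)"
proof -
  let ?y = "biased_point X p A" and ?x = "biased_point X 1 A"
  have rng: "0 \<le> biased_point X r A i \<and> biased_point X r A i \<le> 1" if "i \<in> X" "0 \<le> r" "r \<le> 1" for i r
    using that by (cases "i \<in> A") auto
  have "\<bar>multilinear X f ?y - multilinear X f ?x\<bar> \<le> (\<Sum>i\<in>X. \<bar>?y i - ?x i\<bar>)"
    using rng assms by (intro multilinear_lipschitz) auto
  moreover have "multilinear X f ?x = f A"
    using assms(1,5) by (intro multilinear_indicator) (auto simp: biased_point_def)
  moreover have "\<bar>?y i - ?x i\<bar> = 1 - p" if "i \<in> X" for i
    using that assms(4) by (cases "i \<in> A") simp_all
  then have "(\<Sum>i\<in>X. \<bar>?y i - ?x i\<bar>) = real (card X) * (1 - p)" by simp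
  ultimately show ?thesis by simp
qed

text \<open>Moving \<open>x\<close> up to \<open>C\<close> and down to \<open>C\<close> uses the directions of increasing bias on
  \<open>A \<inter> C\<close> and outside \<open>A \<union> C\<close>; in the remaining directions the gains are nearly of the right sign.\<close>

lemma sum_bias_gain_ge:
  assumes "finite X" "submodular_on X f" "0 \<le> p" "p \<le> 1" "0 \<le> \<kappa>"
    and "\<And>i. i \<in> X \<Longrightarrow> - \<kappa> \<le> bias_gain X f p A i"
  shows "multilinear X f (block_point A C 1 p 1 (1 - p)) + multilinear X f (block_point A C p 0 (1 - p) 0)
      - 2 * multilinear X f (biased_point X p A) - real (card X) * \<kappa>
    \<le> (1 - p) * (\<Sum>i\<in>X. bias_gain X f p A i)"
proof -
  let ?x = "biased_point X p A" and ?y = "block_point A C 1 p 1 (1 - p)" and ?z = "block_point A C p 0 (1 - p) 0"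
  have "multilinear X f ?y \<le> multilinear X f ?x + (\<Sum>i\<in>X. (?y i - ?x i) * marginal X f ?x i)"
  proof (rule multilinear_tangent_up[OF assms(1,2)])
    fix i assume "i \<in> X"
    then show "0 \<le> ?x i \<and> ?x i \<le> ?y i \<and> ?y i \<le> 1"
      using assms(3,4) by (cases "i \<in> A") (auto simp: block_point_def)
  qed
  moreover have "multilinear X f ?z \<le> multilinear X f ?x + (\<Sum>i\<in>X. (?z i - ?x i) * marginal X f ?x i)"
  proof (rule multilinear_tangent_down[OF assms(1,2)])
    fix i assume "i \<in> X"
    then show "0 \<le> ?z i \<and> ?z i \<le> ?x i \<and> ?x i \<le> 1"
      using assms(3,4) by (cases "i \<in> A") (auto simp: block_point_def)
  qed
  moreover have "(\<Sum>i\<in>X. (?y i - ?x i) * marginal X f ?x i) + (\<Sum>i\<in>X. (?z i - ?x i) * marginal X f ?x i)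
      \<le> (\<Sum>i\<in>X. (1 - p) * bias_gain X f p A i + \<kappa>)"
    unfolding sum.distrib[symmetric]
  proof (rule sum_mono)
    fix i assume i: "i \<in> X"
    let ?e = "bias_gain X f p A i"
    have e: "- \<kappa> \<le> ?e" using assms(6) i .
    show "(?y i - ?x i) * marginal X f ?x i + (?z i - ?x i) * marginal X f ?x i \<le> (1 - p) * ?e + \<kappa>"
    proof (cases "i \<in> A \<longleftrightarrow> i \<in> C")
      case True
      then have "(?y i - ?x i) * marginal X f ?x i + (?z i - ?x i) * marginal X f ?x i = (1 - p) * ?e"
        using i by (auto simp: block_point_def bias_gain_def algebra_simps)
      then show ?thesis using assms(5) by simp
    next
      case False
      \<comment> \<open>One of the two points moves coordinate \<open>i\<close> by \<open>p\<close>
        against the bias; \<open>- p * e \<le> (1 - p) * e + \<kappa>\<close> amounts to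
        \<open>- \<kappa> \<le> e\<close>.\<close>
      then have "(?y i - ?x i) * marginal X f ?x i + (?z i - ?x i) * marginal X f ?x i = - p * ?e"
        using i by (auto simp: block_point_def bias_gain_def algebra_simps)
      then show ?thesis using e by (simp add: algebra_simps)
    qed
  qed
  ultimately show ?thesis
    by (simp add: sum.distrib sum_distrib_left)
qed

text \<open>Only coordinates in \<open>C - A\<close> and \<open>A - C\<close> move, each by
  \<open>p\<close> against its gain, so near local optimality limits each contribution to
  \<open>\<kappa>\<close>.\<close>

lemma partial_join_meet_le:
  assumes "finite X" "submodular_on X f" "0 \<le> p" "p \<le> 1" "0 \<le> \<kappa>"
    and "\<And>i. i \<in> X \<Longrightarrow> - \<kappa> \<le> bias_gain X f p A i"
  shows "multilinear X f (block_point A C p p 1 (1 - p)) + multilinear X f (block_point A C p 0 (1 - p) (1 - p))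
    \<le> 2 * multilinear X f (biased_point X p A) + real (card X) * \<kappa>"
proof -
  let ?x = "biased_point X p A" and ?y = "block_point A C p p 1 (1 - p)"
    and ?z = "block_point A C p 0 (1 - p) (1 - p)"
  have "multilinear X f ?y \<le> multilinear X f ?x + (\<Sum>i\<in>X. (?y i - ?x i) * marginal X f ?x i)"
  proof (rule multilinear_tangent_up[OF assms(1,2)])
    fix i assume "i \<in> X"
    then show "0 \<le> ?x i \<and> ?x i \<le> ?y i \<and> ?y i \<le> 1"
      using assms(3,4) by (cases "i \<in> A") (auto simp: block_point_def)
  qed
  moreover have "multilinear X f ?z \<le> multilinear X f ?x + (\<Sum>i\<in>X. (?z i - ?x i) * marginal X f ?x i)"
  proof (rule multilinear_tangent_down[OF assms(1,2)])
    fix i assume "i \<in> X"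
    then show "0 \<le> ?z i \<and> ?z i \<le> ?x i \<and> ?x i \<le> 1"
      using assms(3,4) by (cases "i \<in> A") (auto simp: block_point_def)
  qed
  moreover have "(\<Sum>i\<in>X. (?y i - ?x i) * marginal X f ?x i) + (\<Sum>i\<in>X. (?z i - ?x i) * marginal X f ?x i)
      \<le> (\<Sum>i\<in>X. \<kappa>)"
    unfolding sum.distrib[symmetric]
  proof (rule sum_mono)
    fix i assume i: "i \<in> X"
    let ?e = "bias_gain X f p A i"
    have e: "- ?e \<le> \<kappa>" using assms(6)[OF i] by simp
    show "(?y i - ?x i) * marginal X f ?x i + (?z i - ?x i) * marginal X f ?x i \<le> \<kappa>"
    proof (cases "i \<in> A \<longleftrightarrow> i \<in> C")
      case True
      then show ?thesis
        using i assms(5) by (auto simp: block_point_def)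
    next
      case False
      then have "(?y i - ?x i) * marginal X f ?x i + (?z i - ?x i) * marginal X f ?x i = p * - ?e"
        using i by (auto simp: block_point_def bias_gain_def algebra_simps)
      also have "\<dots> \<le> p * \<kappa>" using e assms(3) by (intro mult_left_mono) auto
      also have "\<dots> \<le> \<kappa>" using assms(3-5) by (intro mult_left_le_one_le)
      finally show ?thesis .
    qed
  qed
  ultimately show ?thesis by simp
qed

section \<open>Growth of the value with the bias\<close>

text \<open>The solution of the differential inequality with \<open>\<gamma> = 1.458\<close>, frozen at its maximum.\<close>

definition level :: "real \<Rightarrow> real" where
  "level p = (let q = max (1 - p) (0.41 / 1.458) in 0.295 + 0.82 * q - 1.458 * q\<^sup>2)"

text \<open>The upper and lower bounds for the partial join and meet are combined. The condition
  \<open>2 * (1 - p)\<^sup>2 \<le> p\<^sup>2\<close> holds from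
  \<open>p = 2 - sqrt 2 = 0.5857...\<close> on, so the window starts just above that point.\<close>

lemma level_start:
  assumes "finite X" "X \<noteq> {}" "submodular_on X f" "\<And>S. S \<subseteq> X \<Longrightarrow> 0 \<le> f S" "A \<subseteq> X" "C \<subseteq> X"
    and "f C = 1" "f A \<le> 0.41" "f (X - A) \<le> 0.41" "0.586 \<le> p" "p \<le> 0.587"
    and "0 \<le> \<kappa>" "real (card X) * \<kappa> \<le> 0.0002" "\<And>i. i \<in> X \<Longrightarrow> - \<kappa> \<le> bias_gain X f p A i"
  shows "level p \<le> multilinear X f (biased_point X p A)"
proof -
  \<comment> \<open>The chord over the window bounds the square from above and the tangent at 0.586
    from below, so the remaining inequalities become linear in \<open>p\<close>.\<close>
  have "(p - 0.586) * (0.587 - p) \<ge> 0" using assms(10,11) by (intro mult_nonneg_nonneg) auto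
  moreover have "(p - 0.586) * (0.587 - p) = 1.173 * p - 0.343982 - p\<^sup>2"
    by (simp add: power2_eq_square field_simps)
  ultimately have sq: "p\<^sup>2 \<le> 1.173 * p - 0.343982" by linarith
  have "(p - 0.586) * (p - 0.586) \<ge> 0" by simp
  moreover have "(p - 0.586) * (p - 0.586) = p\<^sup>2 - 1.172 * p + 0.343396"
    by (simp add: power2_eq_square field_simps)
  ultimately have sq': "p\<^sup>2 \<ge> 1.172 * p - 0.343396" by linarith
  have "2 * (1 - p)\<^sup>2 \<le> p\<^sup>2"
    using sq assms(10) by (simp add: power2_diff algebra_simps)
  then have "(2 * p\<^sup>2 + p * (2 - 3 * p)) * f C - p * (2 - 3 * p) * f A - (p\<^sup>2 - 2 * (1 - p)\<^sup>2) * f (X - A)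
      \<le> 2 * multilinear X f (biased_point X p A) + real (card X) * \<kappa>"
    using assms by (intro order_trans[OF partial_join_meet_ge partial_join_meet_le]) auto
  moreover have "p * (2 - 3 * p) * f A \<le> p * (2 - 3 * p) * 0.41"
    using assms by (intro mult_left_mono mult_nonneg_nonneg) auto
  moreover have "(p\<^sup>2 - 2 * (1 - p)\<^sup>2) * f (X - A) \<le> (p\<^sup>2 - 2 * (1 - p)\<^sup>2) * 0.41"
    using assms \<open>2 * (1 - p)\<^sup>2 \<le> p\<^sup>2\<close> by (intro mult_left_mono) auto
  ultimately have "2 * p\<^sup>2 + p * (2 - 3 * p) - p * (2 - 3 * p) * 0.41 - (p\<^sup>2 - 2 * (1 - p)\<^sup>2) * 0.41
      \<le> 2 * multilinear X f (biased_point X p A) + 0.0002"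
    using assms(7,13) by (simp add: field_simps)
  moreover have "max (1 - p) (0.41 / 1.458) = 1 - p" using assms(11) by simp
  then have "level p = 0.295 + 0.82 * (1 - p) - 1.458 * (1 - p)\<^sup>2" by (simp add: level_def)
  moreover have "2 * p\<^sup>2 + p * (2 - 3 * p) - p * (2 - 3 * p) * 0.41 - (p\<^sup>2 - 2 * (1 - p)\<^sup>2) * 0.41
      = 0.64 * p\<^sup>2 - 0.46 * p + 0.82"
    by (simp add: power2_eq_square field_simps)
  moreover have "0.295 + 0.82 * (1 - p) - 1.458 * (1 - p)\<^sup>2 = 2.096 * p - 0.343 - 1.458 * p\<^sup>2"
    by (simp add: power2_eq_square field_simps)
  ultimately show ?thesis
    using sq' assms(11) by simp
qed

text \<open>The level is concave and hence below its tangent at \<open>p\<close>, even if the step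
  passes the maximum, where it is frozen.\<close>

lemma level_add_le:
  assumes "0 < \<delta>" "0.41 / 1.458 \<le> 1 - p"
  shows "level (p + \<delta>) \<le> level p - \<delta> * (0.82 - 2.916 * (1 - p))"
proof -
  define q :: real where "q = 1 - p"
  have p: "level p = 0.295 + 0.82 * q - 1.458 * q\<^sup>2"
    using assms(2) by (simp add: level_def q_def max_absorb1)
  show ?thesis
  proof (cases "0.41 / 1.458 \<le> q - \<delta>")
    case True
    then have "level (p + \<delta>) = 0.295 + 0.82 * (q - \<delta>) - 1.458 * (q - \<delta>)\<^sup>2"
      by (simp add: level_def q_def max_absorb1 algebra_simps)
    also have "\<dots> = level p - \<delta> * (0.82 - 2.916 * q) - 1.458 * \<delta>\<^sup>2"
      unfolding p by (simp add: power2_eq_square field_simps)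
    finally show ?thesis by (simp add: q_def)
  next
    case False
    define r :: real where "r = 0.41 / 1.458"
    have r: "r \<le> q" "q - \<delta> \<le> r" "1.458 * r = 0.41" using False assms(2) by (auto simp: r_def q_def)
    have max: "max (1 - (p + \<delta>)) r = r" using r by (simp add: q_def)
    have "level (p + \<delta>) = 0.295 + 0.82 * r - 1.458 * r\<^sup>2"
      unfolding level_def Let_def r_def[symmetric] max ..
    also have "\<dots> = level p + 1.458 * (q - r)\<^sup>2"
      unfolding p using r(3) by (simp add: r_def power2_eq_square algebra_simps)
    also have "(q - r)\<^sup>2 \<le> 2 * \<delta> * (q - r)"
    proof -
      have "(q - r) * (q - r) \<le> (2 * \<delta>) * (q - r)" using r assms(1) by (intro mult_right_mono) auto
      then show ?thesis by (simp add: power2_eq_square)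
    qed
    finally show ?thesis using r(3) by (simp add: q_def[symmetric] algebra_simps r_def)
  qed
qed

lemma level_const:
  assumes "1 - p < 0.41 / 1.458" "0 \<le> \<delta>"
  shows "level (p + \<delta>) = level p"
  using assms by (simp add: level_def max_def)

text \<open>One Euler step of the differential inequality; once the level is frozen, gains of at
  least \<open>- \<kappa>\<close> suffice. The losses are the optimality defect and the Taylor
  remainder.\<close>

lemma level_step:
  assumes "finite X" "submodular_on X f" "\<And>S. S \<subseteq> X \<Longrightarrow> 0 \<le> f S \<and> f S \<le> 1" "A \<subseteq> X" "C \<subseteq> X"
    and "f C = 1" "f (X - A) \<le> 0.41" "1 / 2 \<le> p" "0 < \<delta>" "p + \<delta> \<le> 1" "\<delta> \<le> 0.1" "0 \<le> E"
    and "0 \<le> \<kappa>" "\<And>i. i \<in> X \<Longrightarrow> - \<kappa> \<le> bias_gain X f p A i"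
    and "level p - E \<le> multilinear X f (biased_point X p A)"
  shows "level (p + \<delta>) - E - 4 * \<delta> * (real (card X) * \<kappa>) - 2 * (real (card X) * \<delta>)\<^sup>2
    \<le> multilinear X f (biased_point X (p + \<delta>) A)"
proof -
  define S where "S = (\<Sum>i\<in>X. bias_gain X f p A i)"
  define \<phi> where "\<phi> = multilinear X f (biased_point X p A)"
  define k where "k = real (card X) * \<kappa>"
  have k: "0 \<le> k" using assms(13) by (simp add: k_def)
  have taylor: "\<phi> + \<delta> * S - 2 * (real (card X) * \<delta>)\<^sup>2 \<le> multilinear X f (biased_point X (p + \<delta>) A)"
    unfolding \<phi>_def S_def using assms by (intro biased_increase_ge) auto
  show ?thesis
  proof (cases "0.41 / 1.458 \<le> 1 - p")
    case True
    define q where "q = 1 - p"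
    define \<eta> where "\<eta> = \<delta> / q"
    \<comment> \<open>Since \<open>0.41 / 1.458 > 0.28\<close>, the division by \<open>q\<close>
      costs at most a factor 4, and \<open>1 - 2 * \<eta>\<close> stays nonnegative, so the step is
      monotone in \<open>\<phi>\<close>.\<close>
    have q: "0.25 \<le> q" "\<delta> = \<eta> * q" using True by (auto simp: q_def \<eta>_def)
    have \<eta>: "0 \<le> \<eta>" "\<eta> \<le> 4 * \<delta>" "2 * \<eta> \<le> 1"
    proof -
      show "0 \<le> \<eta>" using q assms(9) by (simp add: \<eta>_def)
      show "\<eta> \<le> 4 * \<delta>" using q(1) assms(9) by (simp add: \<eta>_def field_simps)
      then show "2 * \<eta> \<le> 1" using assms(11) by simp
    qed
    have "(f C - (2 * p - 1) * f (X - A)) - 2 * \<phi> - k \<le> q * S"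
      unfolding q_def \<phi>_def S_def k_def using assms
      by (intro order_trans[OF diff_right_mono[OF diff_right_mono[OF join_meet_ge]] sum_bias_gain_ge]) auto
    moreover have "(2 * p - 1) * f (X - A) \<le> (2 * p - 1) * 0.41"
      using assms by (intro mult_left_mono) auto
    ultimately have "1 - 0.41 * (2 * p - 1) - 2 * \<phi> - k \<le> q * S" using assms(6) by (simp add: field_simps)
    then have "\<eta> * (1 - 0.41 * (2 * p - 1) - 2 * \<phi> - k) \<le> \<eta> * (q * S)"
      using \<eta>(1) by (rule mult_left_mono)
    also have "\<dots> = \<delta> * S" unfolding q(2) by simp
    finally have S: "\<eta> * (0.59 + 0.82 * q - 2 * \<phi> - k) \<le> \<delta> * S"
      by (simp add: q_def field_simps)
    have "(1 - 2 * \<eta>) * (level p - E) \<le> (1 - 2 * \<eta>) * \<phi>"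
      unfolding \<phi>_def using assms(15) \<eta> by (intro mult_left_mono) auto
    moreover have "0 \<le> \<eta> * E" using \<eta> assms(12) by simp
    moreover have "\<eta> * k \<le> 4 * \<delta> * k" using \<eta> k by (intro mult_right_mono) auto
    moreover have "max (1 - p) (0.41 / 1.458) = q" using True by (simp add: q_def)
    then have lp: "level p = 0.295 + 0.82 * q - 1.458 * q\<^sup>2" by (simp add: level_def)
    \<comment> \<open>The tangent step of the level is the Euler step of the equation it solves
      exactly.\<close>
    have "level p - \<delta> * (0.82 - 2.916 * q) = (1 - 2 * \<eta>) * level p + \<eta> * (0.59 + 0.82 * q)"
      unfolding lp q(2) by (simp add: power2_eq_square field_simps)
    moreover have "level (p + \<delta>) \<le> level p - \<delta> * (0.82 - 2.916 * q)"
      unfolding q_def using assms(9) True by (rule level_add_le)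
    ultimately have "level (p + \<delta>) - E - 4 * \<delta> * k \<le> \<phi> + \<delta> * S"
      using S by (simp add: algebra_simps)
    then show ?thesis using taylor by (simp add: k_def)
  next
    case False
    have "(\<Sum>i\<in>X. - \<kappa>) \<le> S" unfolding S_def by (intro sum_mono assms)
    then have "\<delta> * - k \<le> \<delta> * S" using assms(9) by (intro mult_left_mono) (auto simp: k_def)
    moreover have "0 \<le> \<delta> * k" using k assms(9) by simp
    moreover have "level (p + \<delta>) = level p" using False assms(9) by (intro level_const) auto
    ultimately show ?thesis using taylor assms(15) by (simp add: \<phi>_def k_def)
  qed
qed

section \<open>Runs of the algorithm with accurate values\<close>

text \<open>Lexicographic descent, valid for any fixed \<open>G\<close>: first the number of phases
  left, then the number of sets that \<open>G\<close> rates strictly above the current one.\<close>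

lemma anneal_terminates:
  assumes "finite X" "X \<noteq> {}"
  shows "anneal_terminates X G"
  unfolding anneal_terminates_def
proof
  assume "\<exists>\<sigma>. \<sigma> 0 = anneal_init \<and> (\<forall>t::nat. anneal_step X G (\<sigma> t) (\<sigma> (Suc t)))"
  then obtain \<sigma> where \<sigma>: "\<sigma> 0 = anneal_init" "\<And>t. anneal_step X G (\<sigma> t) (\<sigma> (Suc t))" by blast
  define better where "better k A = {B \<in> Pow X. G (biased_point X (bias X k) A) < G (biased_point X (bias X k) B)}" for k A
  define h where "h = (\<lambda>(k, A, H :: 'a set set). (card X ^ 3 + 1 - k, card (better k A)))"
  define r where "r = inv_image (less_than <*lex*> less_than) h"
  have sub: "fst (snd (\<sigma> t)) \<subseteq> X" for t
  proof (induction t)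
    case (Suc t)
    from \<sigma>(2)[of t] Suc show ?case by cases auto
  qed (simp add: \<sigma> anneal_init_def)
  have "(\<sigma> (Suc t), \<sigma> t) \<in> r" for t
    using \<sigma>(2)[of t]
  proof cases
    case (flip k i A H)
    let ?A = "sym_diff A {i}"
    have "?A \<subseteq> X" using sub[of t] flip by auto
    then have "better k ?A \<subset> better k A" using flip by (auto simp: better_def)
    then have "card (better k ?A) < card (better k A)"
      using assms(1) by (intro psubset_card_mono) (auto simp: better_def)
    then show ?thesis using flip by (simp add: r_def h_def)
  next
    case (next_phase k A H)
    have "0 < real (card X) ^ 3" using assms by (simp add: card_gt_0_iff)
    then have "real k * 2 < real (card X) ^ 3" using next_phase(3) by (simp add: bias_def field_simps)
    then have "real k < real (card X ^ 3)" unfolding of_nat_power by linarith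
    then have "k < card X ^ 3" by (simp only: of_nat_less_iff)
    then show ?thesis using next_phase by (simp add: r_def h_def Suc_diff_le)
  qed
  moreover have "wf r" unfolding r_def by (intro wf_inv_image wf_lex_prod wf_less_than)
  ultimately show False using wf_iff_no_infinite_down_chain by blast
qed

text \<open>As long as \<open>A\<close> and \<open>X - A\<close> stay below 0.41, a phase cannot be
  the last one, and the level is passed on to the next bias at a cost of \<open>60 / n ^ 4\<close>,
  where \<open>n = card X\<close>.\<close>

lemma phase_end:
  assumes X: "finite X" "10 ^ 6 \<le> card X"
    and f: "submodular_on X f" "\<And>S. S \<subseteq> X \<Longrightarrow> 0 \<le> f S \<and> f S \<le> 1" "C \<subseteq> X" "f C = 1"
    and G: "\<And>x. x \<in> query_points X \<Longrightarrow> \<bar>G x - multilinear X f x\<bar> \<le> 1 / real (card X) ^ 4"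
    and A: "A \<subseteq> X" "f A \<le> 0.41" "f A \<noteq> 0.41" "f (X - A) \<le> 0.41"
    and k: "bias X k < 1"
    and opt: "\<And>i. i \<in> X \<Longrightarrow> G (biased_point X (bias X k) (sym_diff A {i})) \<le> G (biased_point X (bias X k) A)"
    and level: "0.587 \<le> bias X k \<Longrightarrow>
      level (bias X k) - real k * 60 / real (card X) ^ 4 \<le> G (biased_point X (bias X k) A)"
  shows "bias X (Suc k) < 1"
    and "0.587 \<le> bias X (Suc k) \<Longrightarrow>
      level (bias X (Suc k)) - real (Suc k) * 60 / real (card X) ^ 4 \<le> G (biased_point X (bias X (Suc k)) A)"
proof -
  define w where "w = 1 / real (card X)"
  define p where "p = bias X k"
  define \<phi> where "\<phi> = multilinear X f (biased_point X p A)"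
  have "10 ^ 6 \<le> real (card X)" using X(2) by (metis of_nat_le_iff of_nat_numeral of_nat_power)
  then have w: "0 < w" "w \<le> 1 / 10 ^ 6" "real (card X) * w = 1"
    by (auto simp: w_def field_simps)
  have w4: "1 / real (card X) ^ 4 = w ^ 4" and w3: "1 / real (card X) ^ 3 = w ^ 3"
    by (simp_all add: w_def power_one_over)
  have nw: "real (card X) * w ^ 4 = w ^ 3" "real (card X) * w ^ 3 = w\<^sup>2"
    using w(3) by (simp_all add: power4_eq_xxxx power3_eq_cube power2_eq_square flip: mult.assoc)
  have pw: "w\<^sup>2 \<le> w" "w ^ 3 \<le> w" "w ^ 4 \<le> w"
    using w power_decreasing[of 1 _ w] by auto
  have p: "1 / 2 \<le> p" "p < 1" and p': "bias X (Suc k) = p + w ^ 3" and pk: "p = 1 / 2 + real k * w ^ 3"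
    using k w by (auto simp: p_def bias_def w3[symmetric] add_divide_distrib)
  have G': "\<bar>G (biased_point X p B) - multilinear X f (biased_point X p B)\<bar> \<le> w ^ 4" if "B \<subseteq> X" for B
    unfolding w4[symmetric] by (rule G) (use that k in \<open>auto simp: query_points_def p_def\<close>)
  have w_small: "w ^ 3 \<le> 0.001" using pw(2) w(2) by simp
  have "bias X (Suc k) < 1 \<and> (0.587 \<le> bias X (Suc k) \<longrightarrow>
      level (bias X (Suc k)) - real (Suc k) * 60 * w ^ 4 \<le> G (biased_point X (bias X (Suc k)) A))"
  proof (cases "0.586 \<le> p")
    case False
    \<comment> \<open>Steps shorter than the window cannot jump from below 0.586 to 0.587 or
      beyond.\<close>
    then show ?thesis using w_small unfolding p' by simp
  next
    case True
    \<comment> \<open>Two estimates err by at most \<open>2 * w ^ 4\<close> together, and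
      \<open>2 * p - 1 \<ge> 0.172\<close>; \<open>2 / 0.172 < 12\<close>.\<close>
    define \<kappa> where "\<kappa> = 12 * w ^ 4"
    have \<kappa>: "0 \<le> \<kappa>" "real (card X) * \<kappa> = 12 * w ^ 3" using w nw by (auto simp: \<kappa>_def)
    have gain: "- \<kappa> \<le> bias_gain X f p A i" if i: "i \<in> X" for i
    proof -
      let ?e = "bias_gain X f p A i"
      have "sym_diff A {i} \<subseteq> X" using A i by auto
      from G'[OF this] G'[OF A(1)] opt[OF i]
      have "- (2 * w ^ 4) \<le> (2 * p - 1) * ?e"
        unfolding multilinear_biased_flip[OF X(1) i] p_def[symmetric] by linarith
      moreover have "(2 * p - 1) * ?e \<le> (2 * p - 1) * - \<kappa>" if "?e < - \<kappa>"
        using that p by (intro mult_left_mono) auto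
      moreover have "(2 * p - 1) * \<kappa> \<ge> 0.172 * \<kappa>" using True \<kappa> by (intro mult_right_mono) auto
      moreover have "0.172 * \<kappa> > 2 * w ^ 4" using w by (simp add: \<kappa>_def)
      ultimately show ?thesis by (cases "?e < - \<kappa>") auto
    qed
    \<comment> \<open>The cost of \<open>k\<close> phases plus one estimation error.\<close>
    define E where "E = (60 * real k + 1) * w ^ 4"
    have E: "0 \<le> E" using w by (simp add: E_def)
    have "level p - E \<le> \<phi>"
    proof (cases "0.587 \<le> p")
      case True
      have "real k * 60 / real (card X) ^ 4 = 60 * real k * w ^ 4" unfolding w4[symmetric] by simp
      then show ?thesis
        using level True G'[OF A(1)] unfolding p_def[symmetric] \<phi>_def E_def by (simp add: algebra_simps)
    next
      case False
      have "X \<noteq> {}" using X(2) by auto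
      moreover have "real (card X) * \<kappa> \<le> 0.0002" using pw(2) w(2) unfolding \<kappa>(2) by simp
      ultimately have "level p \<le> \<phi>"
        unfolding \<phi>_def using X f A True False gain \<kappa>(1) by (intro level_start[where C = C and \<kappa> = \<kappa>]) auto
      then show ?thesis using E by simp
    qed
    note \<phi> = this
    have lt: "p + w ^ 3 < 1"
    proof (rule ccontr)
      \<comment> \<open>In a last phase \<open>\<phi>\<close> is within \<open>w\<close> of
        \<open>f A\<close>, while the level is at least 0.4102 and, with
        \<open>k * w ^ 3 \<le> 1 / 2\<close>, the error \<open>E\<close> is at most
        \<open>31 * w\<close>. This would push \<open>f A\<close> above 0.41.\<close>
      assume ge: "\<not> p + w ^ 3 < 1"
      have "\<bar>\<phi> - f A\<bar> \<le> real (card X) * (1 - p)"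
        unfolding \<phi>_def using X f A p by (intro abs_biased_diff_le) auto
      also have "\<dots> \<le> real (card X) * w ^ 3" using ge by (intro mult_left_mono) auto
      also have "\<dots> \<le> w" using nw pw by simp
      finally have "\<phi> - w \<le> f A" by linarith
      moreover have "real k * w ^ 3 \<le> 1 / 2" using p(2) unfolding pk by simp
      then have "w * (60 * (real k * w ^ 3)) \<le> w * (60 * (1 / 2))"
        using w by (intro mult_left_mono) auto
      then have "E \<le> 31 * w" using pw(3) unfolding E_def by (simp add: algebra_simps power4_eq_xxxx power3_eq_cube)
      moreover have max: "max (1 - p) (0.41 / 1.458) = 0.41 / 1.458" using ge w_small by simp
      have "level p \<ge> 0.4102"
        unfolding level_def Let_def max by (simp add: power2_eq_square)
      ultimately show False using \<phi> A(2,3) w(2) by simp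
    qed
    have "level (p + w ^ 3) - E - 4 * w ^ 3 * (real (card X) * \<kappa>) - 2 * (real (card X) * w ^ 3)\<^sup>2
        \<le> multilinear X f (biased_point X (p + w ^ 3) A)"
      using X f A p True gain \<kappa>(1) E \<phi> lt w w_small
      by (intro level_step[where C = C]) (auto simp: \<phi>_def)
    moreover have "\<bar>G (biased_point X (p + w ^ 3) A) - multilinear X f (biased_point X (p + w ^ 3) A)\<bar> \<le> w ^ 4"
      unfolding w4[symmetric]
      by (rule G) (use A lt p' in \<open>auto simp: query_points_def intro!: exI[of _ "Suc k"] exI[of _ A]\<close>)
    moreover have "w ^ 3 * w ^ 3 \<le> w ^ 4"
      using w power_decreasing[of 4 6 w] by (simp flip: power_add)
    \<comment> \<open>The losses are \<open>4 * 12\<close> from the optimality defect, 2 from Taylor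
      and 1 from estimation; with the 1 inside \<open>E\<close> they fit into 60.\<close>
    ultimately have "level (p + w ^ 3) - E - 48 * w ^ 4 - 2 * w ^ 4 - w ^ 4 \<le> G (biased_point X (p + w ^ 3) A)"
      unfolding \<kappa>(2) nw by (simp flip: power_mult)
    moreover have "real (Suc k) * 60 * w ^ 4 = E + 59 * w ^ 4" by (simp add: E_def algebra_simps)
    moreover have "0 \<le> w ^ 4" using w by simp
    ultimately have "level (p + w ^ 3) - real (Suc k) * 60 * w ^ 4 \<le> G (biased_point X (p + w ^ 3) A)"
      by linarith
    then show ?thesis using lt unfolding p' by blast
  qed
  moreover have "real (Suc k) * 60 * w ^ 4 = real (Suc k) * 60 / real (card X) ^ 4"
    unfolding w4[symmetric] by simp
  ultimately show "bias X (Suc k) < 1"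
    and "0.587 \<le> bias X (Suc k) \<Longrightarrow>
      level (bias X (Suc k)) - real (Suc k) * 60 / real (card X) ^ 4 \<le> G (biased_point X (bias X (Suc k)) A)"
    by auto
qed

text \<open>Invariant: either a good set has been seen, or the bias is below 1 and the level is met.
  A finished run rules out the second alternative.\<close>

lemma anneal_returns_ge:
  assumes X: "finite X" "10 ^ 6 \<le> card X"
    and f: "submodular_on X f" "\<And>S. S \<subseteq> X \<Longrightarrow> 0 \<le> f S \<and> f S \<le> 1" "C \<subseteq> X" "f C = 1"
    and G: "\<And>x. x \<in> query_points X \<Longrightarrow> \<bar>G x - multilinear X f x\<bar> \<le> 1 / real (card X) ^ 4"
    and S: "anneal_returns X f G S"
  shows "0.41 \<le> f S"
proof -
  obtain k A H where run: "(anneal_step X G)\<^sup>*\<^sup>* anneal_init (k, A, H)" "\<not> bias X k < 1"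
    and max: "is_arg_max f (\<lambda>T. T \<in> H \<union> (\<lambda>B. X - B) ` H) S"
    using S unfolding anneal_returns_def by blast
  define Inv where "Inv = (\<lambda>(k, A, H). A \<subseteq> X \<and> A \<in> H \<and>
    ((\<exists>B\<in>H. 0.41 \<le> f B \<or> 0.41 \<le> f (X - B)) \<or>
     bias X k < 1 \<and> (0.587 \<le> bias X k \<longrightarrow>
       level (bias X k) - real k * 60 / real (card X) ^ 4 \<le> G (biased_point X (bias X k) A))))"
  have step: "Inv s'" if "anneal_step X G s s'" "Inv s" for s s'
    using that(1)
  proof cases
    case (flip k i A H)
    have "sym_diff A {i} \<subseteq> X" using that(2) flip by (auto simp: Inv_def)
    \<comment> \<open>Within a phase a flip only increases the value of \<open>G\<close>.\<close>
    then show ?thesis using that(2) flip unfolding Inv_def by force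
  next
    case (next_phase k A H)
    show ?thesis
    proof (cases "\<exists>B\<in>H. 0.41 \<le> f B \<or> 0.41 \<le> f (X - B)")
      case True
      then show ?thesis using that(2) next_phase by (auto simp: Inv_def)
    next
      case False
      have inv: "A \<subseteq> X" "A \<in> H" "0.587 \<le> bias X k \<longrightarrow>
          level (bias X k) - real k * 60 / real (card X) ^ 4 \<le> G (biased_point X (bias X k) A)"
        using that(2) False unfolding next_phase(1) Inv_def by auto
      then have fA: "f A < 0.41" "f (X - A) < 0.41" using False by (auto simp: not_le)
      have opt: "G (biased_point X (bias X k) (sym_diff A {i})) \<le> G (biased_point X (bias X k) A)"
        if "i \<in> X" for i
        using next_phase(4) that by (auto simp: not_less)
      note facts = X f G inv(1) less_imp_le[OF fA(1)] less_imp_neq[OF fA(1)]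
        less_imp_le[OF fA(2)] next_phase(3) opt inv(3)[rule_format]
      have "bias X (Suc k) < 1" by (rule phase_end(1)[OF facts])
      moreover have "level (bias X (Suc k)) - real (Suc k) * 60 / real (card X) ^ 4
          \<le> G (biased_point X (bias X (Suc k)) A)" if "0.587 \<le> bias X (Suc k)"
        by (rule phase_end(2)[OF facts that])
      ultimately show ?thesis using inv(1,2) unfolding next_phase(2) Inv_def prod.case by blast
    qed
  qed
  have init: "Inv anneal_init" by (simp add: Inv_def anneal_init_def bias_def)
  have "Inv s" if "(anneal_step X G)\<^sup>*\<^sup>* anneal_init s" for s
    using that by (induction rule: rtranclp_induct) (use init step in blast)+
  from this[OF run(1)]
  have "Inv (k, A, H)" .
  then obtain B where "B \<in> H" "0.41 \<le> f B \<or> 0.41 \<le> f (X - B)"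
    using run(2) by (auto simp: Inv_def)
  moreover from this(1) have "f B \<le> f S" "f (X - B) \<le> f S"
    using max unfolding is_arg_max_linorder by blast+
  ultimately show ?thesis by linarith
qed

lemma anneal_returns_subset:
  assumes "anneal_returns X f G S"
  shows "S \<subseteq> X"
proof -
  obtain k A H where run: "(anneal_step X G)\<^sup>*\<^sup>* anneal_init (k, A, H)"
    and max: "is_arg_max f (\<lambda>T. T \<in> H \<union> (\<lambda>B. X - B) ` H) S"
    using assms unfolding anneal_returns_def by blast
  define Inv where "Inv = (\<lambda>(k :: nat, A, H). A \<subseteq> X \<and> H \<subseteq> Pow X)"
  have step: "Inv s'" if "anneal_step X G s s'" "Inv s" for s s'
    using that by cases (auto simp: Inv_def)
  have init: "Inv anneal_init" by (simp add: Inv_def anneal_init_def)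
  have "Inv s" if "(anneal_step X G)\<^sup>*\<^sup>* anneal_init s" for s
    using that by (induction rule: rtranclp_induct) (use init step in blast)+
  from this[OF run]
  have "Inv (k, A, H)" .
  then show ?thesis using max by (auto simp: Inv_def is_arg_max_def)
qed

section \<open>Accuracy of the estimates\<close>

lemma query_point_bounds:
  assumes "x \<in> query_points X" "i \<in> X"
  shows "0 \<le> x i \<and> x i \<le> 1"
proof -
  obtain k A where x: "x = biased_point X (bias X k) A" "bias X k < 1"
    using assms(1) by (auto simp: query_points_def)
  moreover have "1 / 2 \<le> bias X k" by (simp add: bias_def)
  ultimately show ?thesis using assms(2) by (cases "i \<in> A") auto
qed

lemma card_query_points_le:
  assumes "finite X" "X \<noteq> {}"
  shows "card (query_points X) \<le> card X ^ 3 * 2 ^ card X"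
proof -
  have "{k. bias X k < 1} \<subseteq> {..<card X ^ 3}"
  proof
    fix k assume "k \<in> {k. bias X k < 1}"
    moreover have "0 < real (card X) ^ 3" using assms by (simp add: card_gt_0_iff)
    ultimately have "real k * 2 < real (card X) ^ 3" by (simp add: bias_def field_simps)
    then have "real k < real (card X ^ 3)" unfolding of_nat_power by linarith
    then show "k \<in> {..<card X ^ 3}" unfolding of_nat_less_iff by simp
  qed
  then have "query_points X \<subseteq> (\<lambda>(k, A). biased_point X (bias X k) A) ` ({..<card X ^ 3} \<times> Pow X)"
    by (auto simp: query_points_def)
  then have "card (query_points X) \<le> card ({..<card X ^ 3} \<times> Pow X)"
    using assms(1) by (intro surj_card_le) auto
  then show ?thesis using assms(1) by (simp add: card_cartesian_product card_Pow)
qed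

text \<open>Hoeffding's inequality for the \<open>m\<close> independent coordinates of the sample
  that belong to \<open>x\<close>.\<close>

lemma prob_estimate_error_le:
  assumes X: "finite X" "X \<noteq> {}" and f: "\<And>S. S \<subseteq> X \<Longrightarrow> 0 \<le> f S \<and> f S \<le> 1"
    and m: "0 < m" and \<epsilon>: "0 \<le> \<epsilon>" and x: "x \<in> query_points X"
  shows "measure_pmf.prob (sampling X m) {R. \<epsilon> \<le> \<bar>estimate f m R x - multilinear X f x\<bar>}
    \<le> 2 * exp (- 2 * real m * \<epsilon>\<^sup>2)"
proof -
  let ?Q = "query_points X \<times> {..<m}"
  define I where "I = {x} \<times> {..<m}"
  have fin: "finite ?Q" using finite_query_points[OF X] by simp
  have I: "I \<subseteq> ?Q" using x by (auto simp: I_def)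
  interpret H: Hoeffding_ineq "measure_pmf (sampling X m)" I "\<lambda>i R. f (R i)" "\<lambda>_. 0" "\<lambda>_. 1"
    "\<Sum>i\<in>I. measure_pmf.expectation (sampling X m) (\<lambda>R. f (R i))"
  proof unfold_locales
    show "finite I" by (simp add: I_def)
    have "prob_space.indep_vars (measure_pmf (sampling X m)) (\<lambda>_. count_space UNIV) (\<lambda>i R. R i) ?Q"
      unfolding sampling_def using fin by (rule indep_vars_Pi_pmf)
    then have "prob_space.indep_vars (measure_pmf (sampling X m)) (\<lambda>_. count_space UNIV) (\<lambda>i R. R i) I"
      using I by (rule prob_space.indep_vars_subset[OF measure_pmf.prob_space_axioms])
    then show "prob_space.indep_vars (measure_pmf (sampling X m)) (\<lambda>_. borel) (\<lambda>i R. f (R i)) I"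
      by (rule prob_space.indep_vars_compose2[OF measure_pmf.prob_space_axioms]) auto
  next
    fix i assume i: "i \<in> I"
    show "AE R in measure_pmf (sampling X m). f (R i) \<in> {0..1}"
    proof (rule AE_pmfI)
      fix R assume "R \<in> set_pmf (sampling X m)"
      then have "R i \<in> set_pmf (random_subset X x)"
        using i I unfolding sampling_def set_Pi_pmf[OF fin] by (force simp: PiE_dflt_def I_def)
      then show "f (R i) \<in> {0..1}" using set_pmf_random_subset[OF X(1), of x] f by auto
    qed
  qed
  have "measure_pmf.expectation (sampling X m) (\<lambda>R. f (R i)) = multilinear X f x" if "i \<in> I" for i
  proof -
    have "measure_pmf.expectation (sampling X m) (\<lambda>R. f (R i)) =
        measure_pmf.expectation (map_pmf (\<lambda>R. R i) (sampling X m)) f"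
      by simp
    also have "map_pmf (\<lambda>R. R i) (sampling X m) = random_subset X x"
      unfolding sampling_def using that I by (subst Pi_pmf_component[OF fin]) (auto simp: I_def)
    also have "measure_pmf.expectation (random_subset X x) f = multilinear X f x"
      using X(1) query_point_bounds[OF x] by (rule expectation_random_subset)
    finally show ?thesis .
  qed
  then have \<mu>: "(\<Sum>i\<in>I. measure_pmf.expectation (sampling X m) (\<lambda>R. f (R i))) = real m * multilinear X f x"
    by (simp add: I_def)
  have est: "(\<Sum>i\<in>I. f (R i)) = real m * estimate f m R x" for R
  proof -
    have "(\<Sum>i\<in>I. f (R i)) = (\<Sum>j<m. f (R (x, j)))"
      by (rule sum.reindex_bij_witness[of _ "\<lambda>j. (x, j)" snd]) (auto simp: I_def)
    then show ?thesis using m by (simp add: estimate_def)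
  qed
  have "{R. \<epsilon> \<le> \<bar>estimate f m R x - multilinear X f x\<bar>} =
      {R. real m * \<epsilon> \<le> \<bar>(\<Sum>i\<in>I. f (R i)) - real m * multilinear X f x\<bar>}"
    using m by (simp add: est abs_mult flip: right_diff_distrib)
  moreover have "measure_pmf.prob (sampling X m)
      {R. real m * \<epsilon> \<le> \<bar>(\<Sum>i\<in>I. f (R i)) - real m * multilinear X f x\<bar>}
      \<le> 2 * exp (- 2 * (real m * \<epsilon>)\<^sup>2 / real m)"
    using H.Hoeffding_ineq_abs_ge[of "real m * \<epsilon>"] \<epsilon> m unfolding \<mu> by (simp add: I_def)
  moreover have "- 2 * (real m * \<epsilon>)\<^sup>2 / real m = - 2 * real m * \<epsilon>\<^sup>2"
    using m by (simp add: power2_eq_square)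
  ultimately show ?thesis by simp
qed

text \<open>A union bound over all points that any run could query, so adaptive choices of improving
  elements do no harm.\<close>

lemma prob_estimates_accurate:
  assumes X: "finite X" "X \<noteq> {}" and f: "\<And>S. S \<subseteq> X \<Longrightarrow> 0 \<le> f S \<and> f S \<le> 1"
    and m: "0 < m" and \<epsilon>: "0 \<le> \<epsilon>"
  shows "1 - real (card (query_points X)) * (2 * exp (- 2 * real m * \<epsilon>\<^sup>2)) \<le>
    measure_pmf.prob (sampling X m) {R. \<forall>x\<in>query_points X. \<bar>estimate f m R x - multilinear X f x\<bar> \<le> \<epsilon>}"
proof -
  let ?M = "measure_pmf (sampling X m)"
  let ?bad = "\<lambda>x. {R. \<epsilon> \<le> \<bar>estimate f m R x - multilinear X f x\<bar>}"
  have "measure ?M (\<Union>x\<in>query_points X. ?bad x) \<le> (\<Sum>x\<in>query_points X. measure ?M (?bad x))"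
    using finite_query_points[OF X] by (intro measure_pmf.finite_measure_subadditive_finite) auto
  also have "\<dots> \<le> real (card (query_points X)) * (2 * exp (- 2 * real m * \<epsilon>\<^sup>2))"
    using prob_estimate_error_le[OF X f m \<epsilon>] by (intro sum_bounded_above) auto
  finally have "1 - real (card (query_points X)) * (2 * exp (- 2 * real m * \<epsilon>\<^sup>2))
      \<le> 1 - measure ?M (\<Union>x\<in>query_points X. ?bad x)" by simp
  also have "\<dots> = measure ?M (- (\<Union>x\<in>query_points X. ?bad x))"
    using measure_pmf.prob_compl[of "\<Union>x\<in>query_points X. ?bad x" "sampling X m"] by (simp add: Compl_eq_Diff_UNIV)
  also have "\<dots> \<le> measure ?M {R. \<forall>x\<in>query_points X. \<bar>estimate f m R x - multilinear X f x\<bar> \<le> \<epsilon>}"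
    by (intro measure_pmf.finite_measure_mono) (auto simp: not_le less_imp_le)
  finally show ?thesis .
qed

section \<open>Polynomially small failure probability\<close>

lemma power_le_fact_exp:
  fixes x :: real
  assumes "0 \<le> x"
  shows "x ^ k \<le> fact k * exp x"
proof -
  have "(\<Sum>n\<in>{k}. x ^ n /\<^sub>R fact n) \<le> exp x"
    unfolding exp_def by (rule sum_le_suminf) (use assms summable_exp_generic[of x] in auto)
  then show ?thesis by (simp add: field_simps)
qed

text \<open>With accuracy \<open>1 / n ^ 4\<close> and \<open>m \<ge> n ^ 10\<close> the exponent is
  at most \<open>- 2 * n ^ 2\<close>. This beats \<open>n ^ (c + 3) * 2 ^ n\<close>, which is at
  most \<open>fact (c + 3) * exp (2 * n)\<close>.\<close>

lemma failure_probability_le: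
  assumes "1 \<le> n" "n ^ 10 \<le> m"
  shows "real (n ^ 3 * 2 ^ n) * (2 * exp (- 2 * real m * (1 / real n ^ 4)\<^sup>2))
    \<le> 2 * exp 1 * fact (c + 3) / real n ^ c"
proof -
  have n: "0 < real n" using assms by simp
  have "real n ^ 10 \<le> real m" using assms(2) by (metis of_nat_le_iff of_nat_power)
  then have "real n ^ 10 * (1 / real n ^ 4)\<^sup>2 \<le> real m * (1 / real n ^ 4)\<^sup>2" by (intro mult_right_mono) auto
  moreover have "real n ^ 10 * (1 / real n ^ 4)\<^sup>2 = real n ^ 2"
    using n by (simp add: power_divide field_simps flip: power_mult power_add)
  ultimately have "exp (- 2 * real m * (1 / real n ^ 4)\<^sup>2) \<le> exp (- 2 * real n ^ 2)" by simp
  moreover have "(2::real) ^ n \<le> exp (real n)"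
    using exp_ge_add_one_self[of 1] power_mono[of 2 "exp 1 :: real" n] by (simp add: exp_of_nat_mult[symmetric])
  moreover have "real n ^ (c + 3) \<le> fact (c + 3) * exp (real n)" by (rule power_le_fact_exp) simp
  ultimately have "real n ^ (c + 3) * 2 ^ n * exp (- 2 * real m * (1 / real n ^ 4)\<^sup>2)
      \<le> (fact (c + 3) * exp (real n)) * exp (real n) * exp (- 2 * real n ^ 2)"
    by (intro mult_mono) auto
  also have "\<dots> = fact (c + 3) * exp (2 * real n - 2 * real n ^ 2)"
    by (simp add: exp_diff exp_minus mult_exp_exp field_simps)
  also have "\<dots> \<le> fact (c + 3) * exp 1"
  proof -
    have "real n \<le> real n ^ 2" using assms(1) by (simp add: power2_eq_square)
    then have "2 * real n - 2 * real n ^ 2 \<le> 1" by linarith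
    then show ?thesis by simp
  qed
  finally show ?thesis
    using n by (simp add: field_simps power_add)
qed

section \<open>Scaling the maximum to 1, and conclusion\<close>

lemma anneal_step_divide:
  fixes M :: real
  assumes "0 < M"
  shows "anneal_step X (\<lambda>x. G x / M) = anneal_step X G"
  using assms by (intro ext) (simp add: anneal_step.simps divide_less_cancel)

lemma anneal_returns_divide:
  fixes M :: real
  assumes "0 < M"
  shows "anneal_returns X (\<lambda>S. f S / M) (\<lambda>x. G x / M) = anneal_returns X f G"
  using assms
  by (intro ext) (simp add: anneal_returns_def anneal_step_divide is_arg_max_def divide_less_cancel)

lemma estimate_divide: "estimate (\<lambda>S. f S / M) m R = (\<lambda>x. estimate f m R x / M)"
  by (intro ext) (simp add: estimate_def sum_divide_distrib field_simps)

lemma submodular_on_divide: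
  assumes "submodular_on X f" "0 < M"
  shows "submodular_on X (\<lambda>S. f S / M)"
  using assms by (auto simp: submodular_on_def divide_right_mono simp flip: add_divide_distrib)

lemma anneal_success_probability:
  assumes X: "finite X" "10 ^ 6 \<le> card X" and f: "submodular_on X f" "\<And>S. S \<subseteq> X \<Longrightarrow> 0 \<le> f S"
    and m: "card X ^ 10 \<le> m"
  shows "1 - 2 * exp 1 * fact (c + 3) / real (card X) ^ c \<le> measure_pmf.prob (sampling X m)
    {R. anneal_terminates X (estimate f m R) \<and>
        (\<forall>S. anneal_returns X f (estimate f m R) S \<longrightarrow> S \<subseteq> X \<and> f S \<ge> 0.41 * Max (f ` Pow X))}"
proof -
  define M where "M = Max (f ` Pow X)"
  have X0: "X \<noteq> {}" "1 \<le> card X" using X(2) by auto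
  have m0: "0 < m" using m X0 by (metis gr0I le_zero_eq not_one_le_zero power_eq_0_iff)
  have "M \<in> f ` Pow X" unfolding M_def using X(1) by (intro Max_in) auto
  then obtain C where C: "C \<subseteq> X" "f C = M" by auto
  have le: "f S \<le> M" if "S \<subseteq> X" for S unfolding M_def using that X(1) by (intro Max_ge) auto
  show ?thesis
  proof (cases "M = 0")
    \<comment> \<open>No normalisation is possible here, but nonnegativity alone gives the
      bound.\<close>
    case True
    have "{R. anneal_terminates X (estimate f m R) \<and>
        (\<forall>S. anneal_returns X f (estimate f m R) S \<longrightarrow> S \<subseteq> X \<and> f S \<ge> 0.41 * M)} = UNIV"
      using anneal_terminates[OF X(1) X0(1)] f(2) True by (auto dest: anneal_returns_subset)
    then show ?thesis unfolding M_def by simp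
  next
    case False
    then have M: "0 < M" using f(2)[OF C(1)] C(2) by simp
    let ?f = "\<lambda>S. f S / M"
    have f': "submodular_on X ?f" "\<And>S. S \<subseteq> X \<Longrightarrow> 0 \<le> ?f S \<and> ?f S \<le> 1" "?f C = 1"
      using submodular_on_divide[OF f(1) M] f(2) le M C by auto
    have "1 - 2 * exp 1 * fact (c + 3) / real (card X) ^ c \<le>
        1 - real (card (query_points X)) * (2 * exp (- 2 * real m * (1 / real (card X) ^ 4)\<^sup>2))"
    proof -
      have "real (card (query_points X)) * (2 * exp (- 2 * real m * (1 / real (card X) ^ 4)\<^sup>2))
          \<le> real (card X ^ 3 * 2 ^ card X) * (2 * exp (- 2 * real m * (1 / real (card X) ^ 4)\<^sup>2))"
        using card_query_points_le[OF X(1) X0(1)] by (intro mult_right_mono of_nat_mono) auto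
      also have "\<dots> \<le> 2 * exp 1 * fact (c + 3) / real (card X) ^ c"
        using X0(2) m by (rule failure_probability_le)
      finally show ?thesis by simp
    qed
    also have "\<dots> \<le> measure_pmf.prob (sampling X m)
        {R. \<forall>x\<in>query_points X. \<bar>estimate ?f m R x - multilinear X ?f x\<bar> \<le> 1 / real (card X) ^ 4}"
      using X(1) X0(1) f'(2) m0 by (rule prob_estimates_accurate) auto
    also have "\<dots> \<le> measure_pmf.prob (sampling X m)
      {R. anneal_terminates X (estimate f m R) \<and>
        (\<forall>S. anneal_returns X f (estimate f m R) S \<longrightarrow> S \<subseteq> X \<and> f S \<ge> 0.41 * M)}"
    proof (rule measure_pmf.finite_measure_mono, safe)
      fix R S
      assume R: "\<forall>x\<in>query_points X. \<bar>estimate ?f m R x - multilinear X ?f x\<bar> \<le> 1 / real (card X) ^ 4"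
        and S: "anneal_returns X f (estimate f m R) S"
      from S have "anneal_returns X ?f (estimate ?f m R) S"
        by (simp add: estimate_divide anneal_returns_divide[OF M])
      from anneal_returns_ge[OF X f'(1,2) C(1) f'(3) bspec[OF R] this]
      show "0.41 * M \<le> f S" using M by (simp add: field_simps)
    qed (use anneal_terminates[OF X(1) X0(1)] in \<open>auto dest: anneal_returns_subset\<close>)
    finally show ?thesis unfolding M_def .
  qed
qed

theorem theorem3p1:
  shows "\<exists>d::nat. \<forall>c::nat. \<exists>C::real. \<forall>(X :: 'a set) (f :: 'a set \<Rightarrow> real) (m::nat).
    finite X \<longrightarrow> X \<noteq> {} \<longrightarrow> submodular_on X f \<longrightarrow> (\<forall>S\<subseteq>X. 0 \<le> f S) \<longrightarrow> card X ^ d \<le> m \<longrightarrow>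
    measure_pmf.prob (sampling X m)
      {R. anneal_terminates X (estimate f m R) \<and>
          (\<forall>S. anneal_returns X f (estimate f m R) S \<longrightarrow>
             S \<subseteq> X \<and> f S \<ge> 0.41 * Max (f ` Pow X))}
    \<ge> 1 - C / real (card X) ^ c"
proof (rule exI[of _ 10], rule allI)
  fix c :: nat
  \<comment> \<open>The second entry makes the bound trivial for
    \<open>card X < 10 ^ 6\<close>.\<close>
  let ?C = "max (2 * exp 1 * fact (c + 3)) ((10 ^ 6) ^ c) :: real"
  show "\<exists>C::real. \<forall>(X :: 'a set) (f :: 'a set \<Rightarrow> real) (m::nat).
    finite X \<longrightarrow> X \<noteq> {} \<longrightarrow> submodular_on X f \<longrightarrow> (\<forall>S\<subseteq>X. 0 \<le> f S) \<longrightarrow> card X ^ 10 \<le> m \<longrightarrow>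
    measure_pmf.prob (sampling X m)
      {R. anneal_terminates X (estimate f m R) \<and>
          (\<forall>S. anneal_returns X f (estimate f m R) S \<longrightarrow>
             S \<subseteq> X \<and> f S \<ge> 0.41 * Max (f ` Pow X))}
    \<ge> 1 - C / real (card X) ^ c"
  proof (intro exI[of _ ?C] allI impI)
    fix X :: "'a set" and f :: "'a set \<Rightarrow> real" and m :: nat
    assume X: "finite X" "X \<noteq> {}" and f: "submodular_on X f" "\<forall>S\<subseteq>X. 0 \<le> f S"
      and m: "card X ^ 10 \<le> m"
    let ?P = "measure_pmf.prob (sampling X m) {R. anneal_terminates X (estimate f m R) \<and>
          (\<forall>S. anneal_returns X f (estimate f m R) S \<longrightarrow> S \<subseteq> X \<and> f S \<ge> 0.41 * Max (f ` Pow X))}"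
    have n: "0 < real (card X)" using X by (simp add: card_gt_0_iff)
    show "1 - ?C / real (card X) ^ c \<le> ?P"
    proof (cases "10 ^ 6 \<le> card X")
      case True
      have "1 - ?C / real (card X) ^ c \<le> 1 - 2 * exp 1 * fact (c + 3) / real (card X) ^ c"
        using n by (intro diff_left_mono divide_right_mono) auto
      also have "\<dots> \<le> ?P"
        using X(1) True f m by (intro anneal_success_probability) auto
      finally show ?thesis .
    next
      case False
      then have "real (card X) ^ c \<le> (10 ^ 6) ^ c" by (intro power_mono) auto
      then have "1 \<le> ?C / real (card X) ^ c" using n by (simp add: le_divide_eq le_max_iff_disj)
      then show ?thesis using measure_nonneg[of "measure_pmf (sampling X m)"] by (simp add: order_trans[of _ 0])
    qed
  qed
qed

end
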